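(* Let $K\subseteq SM(\mathbb{C})^g$ be a matrix convex set (over $\mathbb{C}$) such that $K=\overline{K}$, and let $K^{\mathbb{R}}=K\cap SM(\mathbb{R})^g$. Then $K$ is the matrix convex hull (over $\mathbb{C}$) of its free extreme points if and only if $K^{\mathbb{R}}$ is the matrix convex hull (over $\mathbb{R}$) of its free extreme points (over $\mathbb{R}$). Furthermore, let $X=X_{\mathbb{R}}+iX_{\mathbb{C}}\in K$, where $X_{\mathbb{R}}$ and $X_{\mathbb{C}}$ are the (entrywise) real and imaginary parts of $X$. If the tuple $$\begin{pmatrix}X_{\mathbb{R}}&X_{\mathbb{C}}\\ X_{\mathbb{C}}^T&X_{\mathbb{R}}\end{pmatrix}\in K^{\mathbb{R}}$$ can be expressed as a matrix convex combination (over $\mathbb{R}$) of free extreme points of $K^{\mathbb{R}}$ whose sum of sizes is at most $m$, then $X$ can also be expressed as a matrix convex combination (over $\mathbb{C}$) of free extreme points of $K$ whose sum of sizes is at most $m$.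
   Context: Let $\mathbb{F}=\mathbb{R}$ or $\mathbb{C}$. $M_{m\times n}(\mathbb{F})$ denotes the $m\times n$ matrices over $\mathbb{F}$; $SM_n(\mathbb{F})^g$ is the set of $g$-tuples of self-adjoint $n\times n$ matrices over $\mathbb{F}$ (real symmetric if $\mathbb{F}=\mathbb{R}$); $SM(\mathbb{F})^g=\bigcup_{n\ge1}SM_n(\mathbb{F})^g$; $K(n)=K\cap SM_n(\mathbb{F})^g$. Operations on tuples are entrywise. $\overline{K}=\{\overline{X}:X\in K\}$ where $\overline{X}=(\overline{X_1},\dots,\overline{X_g})$ is entrywise complex conjugation (not topological closure). Tuples $X,Y$ are unitarily equivalent over $\mathbb{F}$ if $U^*XU=Y$ for a unitary $U$ with entries in $\mathbb{F}$. A matrix convex combination over $\mathbb{F}$ of $X^i\in SM_{n_i}(\mathbb{F})^g$, $i=1,\dots,k$, is a finite sum $\sum_iV_i^*X^iV_i\in SM_n(\mathbb{F})^g$ with $V_i\in M_{n_i\times n}(\mathbb{F})$ and $\sum_iV_i^*V_i=I_n$. A set $K\subseteq SM(\mathbb{F})^g$ is matrix convex if it is closed under matrix convex combinations over $\mathbb{F}$; the matrix convex hull of a set is the set of all matrix convex combinations over $\mathbb{F}$ of its elements. For $K\subseteq SM(\mathbb{C})^g$ the field is $\mathbb{F}=\mathbb{C}$; for $K^{\mathbb{R}}\subseteq SM(\mathbb{R})^g$ the field is $\mathbb{F}=\mathbb{R}$. For $K\subseteq SM(\mathbb{F})^g$, a point $X\in K(n)$ is a free extreme point of $K$ (over $\mathbb{F}$)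 if whenever $X=\sum_{i=1}^kV_i^*X^iV_i$ is a matrix convex combination over $\mathbb{F}$ of $X^i\in K(n_i)$ with $V_i\in M_{n_i\times n}(\mathbb{F})$ and every $V_i\ne0$, then for each $i$ either $n_i=n$ and $X$ is unitarily equivalent over $\mathbb{F}$ to $X^i$, or $n_i>n$ and there is $Z^i\in K$ such that $X\oplus Z^i$ is unitarily equivalent over $\mathbb{F}$ to $X^i$. The size of a tuple in $SM_n(\mathbb{F})^g$ is $n$; the sum of sizes of the tuples $X^i\in SM_{n_i}(\mathbb{F})^g$ in a matrix convex combination is $\sum_i n_i$. *)

theory Defs
  imports "Jordan_Normal_Form.Schur_Decomposition"
begin

text \<open>
  A g-tuple of matrices is a function from a finite type \<open>'g\<close> (with g elements, so g is at least 1)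
  to matrices. The field is the entry type \<open>'a\<close>, which is \<open>real\<close> or \<open>complex\<close>; on \<open>real\<close>,
  \<^const>\<open>conjugate\<close> is the identity, so that \<^const>\<open>mat_adjoint\<close> is the transpose.
\<close>

type_synonym ('g, 'a) mtuple = "'g \<Rightarrow> 'a mat"

definition SMn :: "nat \<Rightarrow> ('g::finite, 'a::conjugatable_field) mtuple set" where
  "SMn n = {X. \<forall>j. X j \<in> carrier_mat n n \<and> mat_adjoint (X j) = X j}"

definition SM :: "('g::finite, 'a::conjugatable_field) mtuple set" where
  "SM = (\<Union>n\<in>{1..}. SMn n)"

text \<open>
  The sum of \<open>A 0, \<dots>, A (k - 1)\<close> for r by c matrices; \<^const>\<open>sum\<close> does not apply, since
  matrices of all sizes share one type, which has no zero.
\<close>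

definition mat_sum :: "nat \<Rightarrow> nat \<Rightarrow> nat \<Rightarrow> (nat \<Rightarrow> 'a::comm_monoid_add mat) \<Rightarrow> 'a mat" where
  "mat_sum r c k A = mat r c (\<lambda>(a, b). \<Sum>i<k. A i $$ (a, b))"

text \<open>
  The tuple \<open>X\<close> of size \<open>n\<close> is the matrix convex combination of the \<open>k\<close> tuples \<open>Y i\<close>, of sizes
  \<open>N i\<close>, with coefficients \<open>V i\<close>.
\<close>

definition matrix_convex_combination ::
  "nat \<Rightarrow> nat \<Rightarrow> (nat \<Rightarrow> nat) \<Rightarrow> (nat \<Rightarrow> 'a::conjugatable_field mat) \<Rightarrow>
    (nat \<Rightarrow> ('g::finite, 'a) mtuple) \<Rightarrow> ('g, 'a) mtuple \<Rightarrow> bool" where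
  "matrix_convex_combination n k N V Y X \<longleftrightarrow>
     1 \<le> n \<and> X \<in> SMn n \<and>
     (\<forall>i<k. 1 \<le> N i \<and> Y i \<in> SMn (N i) \<and> V i \<in> carrier_mat (N i) n) \<and>
     mat_sum n n k (\<lambda>i. mat_adjoint (V i) * V i) = 1\<^sub>m n \<and>
     (\<forall>j. X j = mat_sum n n k (\<lambda>i. mat_adjoint (V i) * Y i j * V i))"

definition matrix_convex_hull ::
  "('g::finite, 'a::conjugatable_field) mtuple set \<Rightarrow> ('g, 'a) mtuple set" where
  "matrix_convex_hull E =
     {X. \<exists>n k N V Y. matrix_convex_combination n k N V Y X \<and> (\<forall>i<k. Y i \<in> E)}"

definition matrix_convex :: "('g::finite, 'a::conjugatable_field) mtuple set \<Rightarrow> bool" where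
  "matrix_convex K \<longleftrightarrow> K \<subseteq> SM \<and>
     (\<forall>n k N V Y X. matrix_convex_combination n k N V Y X \<and> (\<forall>i<k. Y i \<in> K) \<longrightarrow> X \<in> K)"

definition combination_of_total_size_le ::
  "('g::finite, 'a::conjugatable_field) mtuple set \<Rightarrow> nat \<Rightarrow> ('g, 'a) mtuple \<Rightarrow> bool" where
  "combination_of_total_size_le E m X \<longleftrightarrow>
     (\<exists>n k N V Y. matrix_convex_combination n k N V Y X \<and> (\<forall>i<k. Y i \<in> E) \<and> (\<Sum>i<k. N i) \<le> m)"

definition unitary_mat :: "nat \<Rightarrow> 'a::conjugatable_field mat \<Rightarrow> bool" where
  "unitary_mat n U \<longleftrightarrow>
     U \<in> carrier_mat n n \<and> mat_adjoint U * U = 1\<^sub>m n \<and> U * mat_adjoint U = 1\<^sub>m n"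

definition unitarily_equivalent ::
  "nat \<Rightarrow> ('g::finite, 'a::conjugatable_field) mtuple \<Rightarrow> ('g, 'a) mtuple \<Rightarrow> bool" where
  "unitarily_equivalent n X Y \<longleftrightarrow>
     X \<in> SMn n \<and> Y \<in> SMn n \<and>
     (\<exists>U. unitary_mat n U \<and> (\<forall>j. mat_adjoint U * X j * U = Y j))"

definition direct_sum ::
  "('g::finite, 'a::zero) mtuple \<Rightarrow> ('g, 'a) mtuple \<Rightarrow> ('g, 'a) mtuple" where
  "direct_sum X Z = (\<lambda>j. four_block_mat
     (X j) (0\<^sub>m (dim_row (X j)) (dim_col (Z j)))
     (0\<^sub>m (dim_row (Z j)) (dim_col (X j))) (Z j))"

definition free_extreme_points ::
  "('g::finite, 'a::conjugatable_field) mtuple set \<Rightarrow> ('g, 'a) mtuple set" where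
  "free_extreme_points K =
     {X. \<exists>n\<ge>1. X \<in> K \<inter> SMn n \<and>
       (\<forall>k N V Y. matrix_convex_combination n k N V Y X \<and>
           (\<forall>i<k. Y i \<in> K \<and> V i \<noteq> 0\<^sub>m (N i) n) \<longrightarrow>
         (\<forall>i<k. (N i = n \<and> unitarily_equivalent n X (Y i)) \<or>
                (N i > n \<and> (\<exists>Z \<in> K. unitarily_equivalent (N i) (direct_sum X Z) (Y i)))))}"

definition conj_tuple :: "('g::finite, complex) mtuple \<Rightarrow> ('g, complex) mtuple" where
  "conj_tuple X = (\<lambda>j. map_mat cnj (X j))"

text \<open>
  The real points of \<open>K\<close>, with a real tuple identified with its image under the entrywise
  embedding of the reals into the complex numbers.
\<close>

definition real_points :: "('g::finite, complex) mtuple set \<Rightarrow> ('g, real) mtuple set" where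
  "real_points K = {X \<in> SM. (\<lambda>j. map_mat complex_of_real (X j)) \<in> K}"

definition realification :: "('g::finite, complex) mtuple \<Rightarrow> ('g, real) mtuple" where
  "realification X = (\<lambda>j. four_block_mat
     (map_mat Re (X j)) (map_mat Im (X j))
     (transpose_mat (map_mat Im (X j))) (map_mat Re (X j)))"

end

theory Submission
  imports Defs "Jordan_Normal_Form.Spectral_Radius"
begin

text \<open>
  Free extreme points behave badly under a change of field: a free extreme point of the real points
  may split over the complex numbers, and the realification of a free extreme point of \<open>K\<close> may split
  over the reals. The proof replaces them by Arveson extreme points, the tuples \<open>X\<close> of \<open>K\<close> for which
  every combination \<open>X = \<Sum> (V i)\<^sup>\<dagger> * Y i * V i\<close> satisfies \<open>Y i * V i = V i * X\<close>. This property asks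
  for no irreducibility, so it survives the splitting, and over either field it is as good as free
  extremality:

  \<^item> A free extreme point is Arveson extreme (\<open>free_extreme_imp_arveson_extreme\<close>). The columns of
    \<open>T i = Y i * V i - V i * X\<close> are orthogonal to the coefficients \<open>V i\<close>, and a column \<open>w\<close> orthogonal to
    them, normalized, borders \<open>X\<close> to an element of \<open>K\<close> one size larger. Free extremality makes this
    element unitarily equivalent to a direct sum with \<open>X\<close>, and comparing the traces of the squares
    shows that the border \<open>\<Sum> (V i)\<^sup>\<dagger> * Y i * w i\<close> is zero. This forces \<open>\<Sum> (T i)\<^sup>\<dagger> * T i = 0\<close>.

  \<^item> An Arveson extreme point of size \<open>n\<close> is a combination of free extreme points of total size at
    most \<open>n\<close> (\<open>arveson_extreme_combination\<close>). If it is not free extreme, some \<open>(V i)\<^sup>\<dagger> * V i\<close> commutes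
    with it without being scalar, an eigenspace splits it, and both summands are Arveson extreme of
    smaller size.

  The change of field is then matrix algebra. With \<open>J = (1, \<i>)\<^sup>T / sqrt 2\<close>, the realification \<open>R X\<close>
  satisfies \<open>R X * J = J * X\<close>, hence \<open>J\<^sup>\<dagger> * R X * J = X\<close>, and with \<open>C = (Re V, - Im V)\<^sup>T\<close> it
  satisfies \<open>Re (V\<^sup>\<dagger> * X * V) = C\<^sup>\<dagger> * R X * C\<close>. The first identity turns real combinations for \<open>R X\<close>
  into complex ones for \<open>X\<close>, the second turns complex combinations for a real tuple into real ones.
  Consequently real Arveson extreme points are Arveson extreme over the complex numbers, and
  realifications of complex ones are Arveson extreme over the reals. So a free extreme point of the
  real points of size \<open>n\<close> is a combination of free extreme points of \<open>K\<close> of total size at most \<open>n\<close>,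
  and the realification of a free extreme point of \<open>K\<close> is a combination of free extreme points of the
  real points. Substituting these into given combinations proves the equivalence and the bound.
\<close>

section \<open>Matrix algebra\<close>

notation mat_adjoint ("_\<^sup>\<dagger>" [1000] 999)

lemma dim_mat_adjoint [simp]:
  "dim_row (A\<^sup>\<dagger>) = dim_col A" "dim_col (A\<^sup>\<dagger>) = dim_row A"
  by (auto simp: mat_adjoint_def)

lemma mat_adjoint_carrier [simp]: "A \<in> carrier_mat r c \<Longrightarrow> A\<^sup>\<dagger> \<in> carrier_mat c r"
  by auto

lemma mat_adjoint_index [simp]:
  "i < dim_col A \<Longrightarrow> j < dim_row A \<Longrightarrow> A\<^sup>\<dagger> $$ (i, j) = conjugate (A $$ (j, i))"
  by (auto simp: mat_adjoint_def mat_of_rows_def)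

lemma mult_index:
  "i < dim_row A \<Longrightarrow> j < dim_col B \<Longrightarrow> dim_col A = dim_row B \<Longrightarrow>
    (A * B) $$ (i, j) = (\<Sum>l<dim_row B. A $$ (i, l) * B $$ (l, j))"
  by (simp add: scalar_prod_def lessThan_atLeast0)

text \<open>
  The ring laws below have conditions on dimensions instead of carriers: the dimensions of a product
  can be computed from its factors, whereas a carrier condition leaves the inner dimension to be
  guessed.
\<close>

lemma mult_assoc_dim:
  fixes A B C :: "'a::semiring_0 mat"
  shows "dim_col A = dim_row B \<Longrightarrow> dim_col B = dim_row C \<Longrightarrow> A * B * C = A * (B * C)"
  by (rule assoc_mult_mat[of A _ _ B _ C]) auto

lemma mult_add_dim:
  fixes A B C :: "'a::semiring_0 mat"
  shows "dim_col A = dim_row B \<Longrightarrow> dim_row B = dim_row C \<Longrightarrow> dim_col B = dim_col C \<Longrightarrow>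
    A * (B + C) = A * B + A * C"
  by (rule mult_add_distrib_mat[of A _ _ B _ C]) auto

lemma add_mult_dim:
  fixes A B C :: "'a::semiring_0 mat"
  shows "dim_row A = dim_row B \<Longrightarrow> dim_col A = dim_col B \<Longrightarrow> dim_col B = dim_row C \<Longrightarrow>
    (A + B) * C = A * C + B * C"
  by (rule add_mult_distrib_mat[of A _ _ B C]) auto

lemma mult_minus_dim:
  fixes A B C :: "'a::ring mat"
  shows "dim_col A = dim_row B \<Longrightarrow> dim_row B = dim_row C \<Longrightarrow> dim_col B = dim_col C \<Longrightarrow>
    A * (B - C) = A * B - A * C"
  by (rule mult_minus_distrib_mat[of A _ _ B _ C]) auto

lemma minus_mult_dim:
  fixes A B C :: "'a::ring mat"
  shows "dim_row A = dim_row B \<Longrightarrow> dim_col A = dim_col B \<Longrightarrow> dim_col B = dim_row C \<Longrightarrow>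
    (A - B) * C = A * C - B * C"
  by (rule minus_mult_distrib_mat[of A _ _ B C]) auto

lemma smult_mult_dim:
  fixes A B :: "'a::comm_semiring_0 mat"
  shows "dim_col A = dim_row B \<Longrightarrow> (c \<cdot>\<^sub>m A) * B = c \<cdot>\<^sub>m (A * B)"
  by (rule mult_smult_assoc_mat[of A _ _ B]) auto

lemma mult_smult_dim:
  fixes A B :: "'a::comm_semiring_0 mat"
  shows "dim_col A = dim_row B \<Longrightarrow> A * (c \<cdot>\<^sub>m B) = c \<cdot>\<^sub>m (A * B)"
  by (rule mult_smult_distrib[of A _ _ B]) auto

lemma one_mult_dim [simp]:
  fixes A :: "'a::semiring_1 mat"
  shows "dim_row A = n \<Longrightarrow> 1\<^sub>m n * A = A" "dim_col A = n \<Longrightarrow> A * 1\<^sub>m n = A"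
  by (auto intro: left_mult_one_mat right_mult_one_mat)

lemma zero_mult_dim [simp]:
  fixes A :: "'a::semiring_1 mat"
  shows "dim_row A = n \<Longrightarrow> 0\<^sub>m m n * A = 0\<^sub>m m (dim_col A)"
    "dim_col A = n \<Longrightarrow> A * 0\<^sub>m n m = 0\<^sub>m (dim_row A) m"
  by (auto intro!: left_mult_zero_mat right_mult_zero_mat)

lemma adjoint_mult:
  fixes A B :: "'a::conjugatable_field mat"
  shows "dim_col A = dim_row B \<Longrightarrow> (A * B)\<^sup>\<dagger> = B\<^sup>\<dagger> * A\<^sup>\<dagger>"
  by (rule eq_matI) (auto simp: mult_index sum_conjugate conjugate_dist_mul mult.commute
      simp del: index_mult_mat(1))

lemma adjoint_adjoint [simp]: "(A\<^sup>\<dagger>)\<^sup>\<dagger> = A"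
  by (rule eq_matI) auto

lemma adjoint_smult: "(c \<cdot>\<^sub>m A)\<^sup>\<dagger> = conjugate c \<cdot>\<^sub>m A\<^sup>\<dagger>"
  by (rule eq_matI) (auto simp: conjugate_dist_mul)

lemma adjoint_minus:
  "dim_row A = dim_row B \<Longrightarrow> dim_col A = dim_col B \<Longrightarrow> (A - B)\<^sup>\<dagger> = A\<^sup>\<dagger> - B\<^sup>\<dagger>"
  by (rule eq_matI) (auto simp: conjugate_dist_add conjugate_neg
      simp flip: add_uminus_conv_diff)

lemma adjoint_zero [simp]: "(0\<^sub>m r c)\<^sup>\<dagger> = 0\<^sub>m c r"
  by (rule eq_matI) auto

lemma conjugate_one [simp]: "conjugate (1::'a::conjugatable_field) = 1"
proof -
  have "conjugate (1::'a) * conjugate 1 = conjugate 1 * 1"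
    using conjugate_dist_mul[of "1::'a" 1] by simp
  then show ?thesis
    by (metis conjugate_zero_iff mult_left_cancel zero_neq_one)
qed

lemma adjoint_one [simp]: "(1\<^sub>m n)\<^sup>\<dagger> = 1\<^sub>m n"
  by (rule eq_matI) auto

lemma conjugate_inverse: "conjugate (inverse s) = inverse (conjugate (s::'a::conjugatable_field))"
proof (cases "s = 0")
  case False
  then have "conjugate s * conjugate (inverse s) = 1"
    by (simp flip: conjugate_dist_mul)
  then show ?thesis
    by (metis inverse_unique)
qed simp

lemma minus_eq_zero_mat:
  fixes A B :: "'a::ring mat"
  assumes "A - B = 0\<^sub>m r c" "A \<in> carrier_mat r c" "B \<in> carrier_mat r c"
  shows "A = B"
proof (rule eq_matI)
  fix i j assume ij: "i < dim_row B" "j < dim_col B"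
  then have "(A - B) $$ (i, j) = 0"
    using assms by simp
  moreover have "(A - B) $$ (i, j) = A $$ (i, j) - B $$ (i, j)"
    using ij by simp
  ultimately show "A $$ (i, j) = B $$ (i, j)"
    by simp
qed (use assms in auto)

lemma add_diff_cancel_mat:
  fixes A B :: "'a::ring mat"
  assumes "A \<in> carrier_mat r c" "B \<in> carrier_mat r c"
  shows "A + (B - A) = B"
  using assms by auto

lemma minus_self_mat [simp]:
  fixes A :: "'a::ring mat"
  shows "A - A = 0\<^sub>m (dim_row A) (dim_col A)"
  by auto

lemma minus_zero_mat_dim [simp]:
  fixes A :: "'a::ring mat"
  shows "dim_row A = r \<Longrightarrow> dim_col A = c \<Longrightarrow> A - 0\<^sub>m r c = A"
  by auto

lemma add_zero_mat_dim [simp]: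
  fixes A :: "'a::monoid_add mat"
  shows "dim_row A = r \<Longrightarrow> dim_col A = c \<Longrightarrow> A + 0\<^sub>m r c = A"
    "dim_row A = r \<Longrightarrow> dim_col A = c \<Longrightarrow> 0\<^sub>m r c + A = A"
  by auto

definition unit_col :: "nat \<Rightarrow> nat \<Rightarrow> 'a::zero_neq_one mat" where
  "unit_col p c = mat p 1 (\<lambda>(a, b). if a = c then 1 else 0)"

lemma unit_col_carrier [simp]: "unit_col p c \<in> carrier_mat p 1"
  "dim_row (unit_col p c) = p" "dim_col (unit_col p c) = 1"
  by (auto simp: unit_col_def)

lemma mult_unit_col_index:
  fixes A :: "'a::semiring_1 mat"
  assumes "a < dim_row A" "c < dim_col A"
  shows "(A * unit_col (dim_col A) c) $$ (a, 0) = A $$ (a, c)"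
proof -
  have "(A * unit_col (dim_col A) c) $$ (a, 0) =
      (\<Sum>l<dim_col A. A $$ (a, l) * (if l = c then 1 else 0))"
    using assms by (subst mult_index) (auto simp: unit_col_def)
  also have "\<dots> = A $$ (a, c)"
    using assms by (simp add: if_distrib sum.delta cong: if_cong)
  finally show ?thesis .
qed

lemma eq_mat_columnwise:
  fixes A B :: "'a::semiring_1 mat"
  assumes "A \<in> carrier_mat r p" "B \<in> carrier_mat r p"
    and "\<And>c. c < p \<Longrightarrow> A * unit_col p c = B * unit_col p c"
  shows "A = B"
proof (rule eq_matI)
  fix i j assume "i < dim_row B" "j < dim_col B"
  then show "A $$ (i, j) = B $$ (i, j)"
    using assms mult_unit_col_index[of i A j] mult_unit_col_index[of i B j] by auto
qed (use assms in auto)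

definition mat_trace :: "'a::comm_monoid_add mat \<Rightarrow> 'a" where
  "mat_trace A = (\<Sum>i<dim_row A. A $$ (i, i))"

lemma mat_trace_comm:
  fixes A B :: "'a::comm_semiring_0 mat"
  assumes "A \<in> carrier_mat m n" "B \<in> carrier_mat n m"
  shows "mat_trace (A * B) = mat_trace (B * A)"
proof -
  have "mat_trace (A * B) = (\<Sum>i<m. \<Sum>l<n. A $$ (i, l) * B $$ (l, i))"
    using assms by (auto simp: mat_trace_def mult_index simp del: index_mult_mat(1) intro!: sum.cong)
  also have "\<dots> = (\<Sum>l<n. \<Sum>i<m. B $$ (l, i) * A $$ (i, l))"
    by (subst sum.swap) (simp add: mult.commute)
  also have "\<dots> = mat_trace (B * A)"
    using assms by (auto simp: mat_trace_def mult_index simp del: index_mult_mat(1) intro!: sum.cong)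
  finally show ?thesis .
qed

section \<open>Finite sums of matrices\<close>

lemma mat_sum_carrier [simp]: "mat_sum r c k A \<in> carrier_mat r c"
  "dim_row (mat_sum r c k A) = r" "dim_col (mat_sum r c k A) = c"
  by (auto simp: mat_sum_def)

lemma mat_sum_index [simp]:
  "a < r \<Longrightarrow> b < c \<Longrightarrow> mat_sum r c k A $$ (a, b) = (\<Sum>i<k. A i $$ (a, b))"
  by (simp add: mat_sum_def)

lemma mat_sum_0 [simp]: "mat_sum r c 0 A = 0\<^sub>m r c"
  by (rule eq_matI) auto

lemma mat_sum_Suc:
  "A k \<in> carrier_mat r c \<Longrightarrow> mat_sum r c (Suc k) A = mat_sum r c k A + A k"
  by (rule eq_matI) auto

lemma mat_sum_1: "A 0 \<in> carrier_mat r c \<Longrightarrow> mat_sum r c (Suc 0) A = A 0"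
  by (rule eq_matI) auto

lemma mat_sum_cong:
  "(\<And>i. i < k \<Longrightarrow> A i = B i) \<Longrightarrow> mat_sum r c k A = mat_sum r c k B"
  by (rule eq_matI) auto

lemma mat_sum_minus:
  fixes A B :: "nat \<Rightarrow> 'a::ab_group_add mat"
  assumes "\<And>i. i < k \<Longrightarrow> A i \<in> carrier_mat r c" "\<And>i. i < k \<Longrightarrow> B i \<in> carrier_mat r c"
  shows "mat_sum r c k (\<lambda>i. A i - B i) = mat_sum r c k A - mat_sum r c k B"
proof (rule eq_matI)
  fix a b assume ab: "a < dim_row (mat_sum r c k A - mat_sum r c k B)"
    "b < dim_col (mat_sum r c k A - mat_sum r c k B)"
  have "(A i - B i) $$ (a, b) = A i $$ (a, b) - B i $$ (a, b)" if "i < k" for i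
    using ab assms(2)[OF that] by auto
  then show "mat_sum r c k (\<lambda>i. A i - B i) $$ (a, b) = (mat_sum r c k A - mat_sum r c k B) $$ (a, b)"
    using ab by (simp add: sum_subtractf)
qed auto

lemma mat_sum_append:
  fixes A B :: "nat \<Rightarrow> 'a::comm_monoid_add mat"
  shows "mat_sum r c (k + l) (\<lambda>i. if i < k then A i else B (i - k)) =
    mat_sum r c k A + mat_sum r c l B"
proof (rule eq_matI)
  fix a b assume ab: "a < dim_row (mat_sum r c k A + mat_sum r c l B)"
    "b < dim_col (mat_sum r c k A + mat_sum r c l B)"
  have "(\<Sum>i<k + l. (if i < k then A i else B (i - k)) $$ (a, b)) =
      (\<Sum>i<k. A i $$ (a, b)) + (\<Sum>i<l. B i $$ (a, b))"
    by (induction l) (simp_all add: add.assoc)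
  then show "mat_sum r c (k + l) (\<lambda>i. if i < k then A i else B (i - k)) $$ (a, b) =
      (mat_sum r c k A + mat_sum r c l B) $$ (a, b)"
    using ab by simp
qed auto

lemma mult_mat_sum:
  fixes A :: "nat \<Rightarrow> 'a::semiring_1 mat"
  assumes "P \<in> carrier_mat p r" "\<And>i. i < k \<Longrightarrow> A i \<in> carrier_mat r c"
  shows "P * mat_sum r c k A = mat_sum p c k (\<lambda>i. P * A i)"
  using assms(2)
proof (induction k)
  case 0
  then show ?case using assms(1) by simp
next
  case (Suc k)
  have A: "A k \<in> carrier_mat r c" using Suc.prems by simp
  then have "P * A k \<in> carrier_mat p c" using assms(1) by simp
  with A show ?case
    using assms(1) Suc.IH Suc.prems carrier_matD[OF A] carrier_matD[OF assms(1)]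
    by (subst (1 2) mat_sum_Suc) (simp_all add: mult_add_dim)
qed

lemma mat_sum_mult:
  fixes A :: "nat \<Rightarrow> 'a::semiring_1 mat"
  assumes "P \<in> carrier_mat c p" "\<And>i. i < k \<Longrightarrow> A i \<in> carrier_mat r c"
  shows "mat_sum r c k A * P = mat_sum r p k (\<lambda>i. A i * P)"
  using assms(2)
proof (induction k)
  case 0
  then show ?case using assms(1) by simp
next
  case (Suc k)
  have A: "A k \<in> carrier_mat r c" using Suc.prems by simp
  then have "A k * P \<in> carrier_mat r p" using assms(1) by simp
  with A show ?case
    using assms(1) Suc.IH Suc.prems carrier_matD[OF A] carrier_matD[OF assms(1)]
    by (subst (1 2) mat_sum_Suc) (simp_all add: add_mult_dim)
qed

lemma mult_mat_sum_mult:
  fixes A :: "nat \<Rightarrow> 'a::semiring_1 mat"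
  assumes "P \<in> carrier_mat p r" "Q \<in> carrier_mat c q" "\<And>i. i < k \<Longrightarrow> A i \<in> carrier_mat r c"
  shows "P * mat_sum r c k A * Q = mat_sum p q k (\<lambda>i. P * A i * Q)"
proof -
  have "P * mat_sum r c k A = mat_sum p c k (\<lambda>i. P * A i)"
    by (rule mult_mat_sum[OF assms(1,3)])
  moreover have "mat_sum p c k (\<lambda>i. P * A i) * Q = mat_sum p q k (\<lambda>i. P * A i * Q)"
    by (rule mat_sum_mult[OF assms(2)]) (rule mult_carrier_mat[OF assms(1,3)])
  ultimately show ?thesis by simp
qed

lemma gram_diagonal:
  fixes A :: "'a::conjugatable_field mat"
  assumes "A \<in> carrier_mat r c" "b < c"
  shows "(A\<^sup>\<dagger> * A) $$ (b, b) = (\<Sum>l<r. A $$ (l, b) * conjugate (A $$ (l, b)))"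
  using assms by (subst mult_index) (auto simp: mult.commute)

text \<open>
  The diagonal entries of a sum of Gram matrices are sums of the nonnegative \<open>a * conjugate a\<close>, where
  \<open>a\<close> runs through the entries of all the \<open>T i\<close>.
\<close>

lemma mat_sum_gram_eq_zero:
  fixes T :: "nat \<Rightarrow> 'a::conjugatable_ordered_field mat"
  assumes T: "\<And>i. i < k \<Longrightarrow> T i \<in> carrier_mat (N i) p"
    and zero: "mat_sum p p k (\<lambda>i. (T i)\<^sup>\<dagger> * T i) = 0\<^sub>m p p" and i: "i < k"
  shows "T i = 0\<^sub>m (N i) p"
proof (rule eq_matI)
  fix a b assume "a < dim_row (0\<^sub>m (N i) p)" "b < dim_col (0\<^sub>m (N i) p)"
  then have ab: "a < N i" "b < p" by auto
  have "(\<Sum>i<k. \<Sum>l<N i. T i $$ (l, b) * conjugate (T i $$ (l, b))) =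
      (\<Sum>i<k. ((T i)\<^sup>\<dagger> * T i) $$ (b, b))"
    by (intro sum.cong refl gram_diagonal[OF T \<open>b < p\<close>, symmetric]) simp
  also have "\<dots> = 0"
    using arg_cong[OF zero, of "\<lambda>A. A $$ (b, b)"] ab by (simp del: index_mult_mat(1))
  finally have "(\<Sum>l<N i. T i $$ (l, b) * conjugate (T i $$ (l, b))) = 0"
    using i by (subst (asm) sum_nonneg_eq_0_iff)
      (auto intro!: sum_nonneg conjugate_square_positive)
  then have "T i $$ (a, b) * conjugate (T i $$ (a, b)) = 0"
    using ab by (subst (asm) sum_nonneg_eq_0_iff) (auto intro!: conjugate_square_positive)
  then show "T i $$ (a, b) = 0\<^sub>m (N i) p $$ (a, b)"
    using ab by simp
qed (use T[OF i] in auto)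

lemma gram_eq_zero:
  fixes A :: "'a::conjugatable_ordered_field mat"
  assumes "A \<in> carrier_mat r c" "A\<^sup>\<dagger> * A = 0\<^sub>m c c"
  shows "A = 0\<^sub>m r c"
  using mat_sum_gram_eq_zero[of 1 "\<lambda>_. A" "\<lambda>_. r" c 0] assms
  by (simp add: mat_sum_1)

lemma mat_trace_gram_nonneg:
  fixes A :: "'a::conjugatable_ordered_field mat"
  shows "0 \<le> mat_trace (A\<^sup>\<dagger> * A)"
proof -
  have "mat_trace (A\<^sup>\<dagger> * A) = (\<Sum>b<dim_col A. (A\<^sup>\<dagger> * A) $$ (b, b))"
    by (simp add: mat_trace_def)
  also have "\<dots> = (\<Sum>b<dim_col A. \<Sum>l<dim_row A. A $$ (l, b) * conjugate (A $$ (l, b)))"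
    by (intro sum.cong refl gram_diagonal) auto
  finally show ?thesis
    by (simp add: sum_nonneg conjugate_square_positive)
qed

section \<open>Block matrices\<close>

lemma adjoint_mat_sum:
  assumes "\<And>i. i < k \<Longrightarrow> A i \<in> carrier_mat r c"
  shows "(mat_sum r c k A)\<^sup>\<dagger> = mat_sum c r k (\<lambda>i. (A i)\<^sup>\<dagger>)"
proof (rule eq_matI)
  fix a b assume ab: "a < dim_row (mat_sum c r k (\<lambda>i. (A i)\<^sup>\<dagger>))" "b < dim_col (mat_sum c r k (\<lambda>i. (A i)\<^sup>\<dagger>))"
  have "(A i)\<^sup>\<dagger> $$ (a, b) = conjugate (A i $$ (b, a))" if "i < k" for i
    using ab carrier_matD[OF assms[OF that]] by simp
  then show "(mat_sum r c k A)\<^sup>\<dagger> $$ (a, b) = mat_sum c r k (\<lambda>i. (A i)\<^sup>\<dagger>) $$ (a, b)"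
    using ab by (simp add: sum_conjugate)
qed auto

lemma mat_sum_four_block:
  assumes "\<And>i. i < k \<Longrightarrow> A i \<in> carrier_mat r c" "\<And>i. i < k \<Longrightarrow> B i \<in> carrier_mat r c'"
    "\<And>i. i < k \<Longrightarrow> C i \<in> carrier_mat r' c" "\<And>i. i < k \<Longrightarrow> D i \<in> carrier_mat r' c'"
  shows "mat_sum (r + r') (c + c') k (\<lambda>i. four_block_mat (A i) (B i) (C i) (D i)) =
    four_block_mat (mat_sum r c k A) (mat_sum r c' k B) (mat_sum r' c k C) (mat_sum r' c' k D)"
    (is "?L = ?R")
proof (rule eq_matI)
  fix a b assume ab: "a < dim_row ?R" "b < dim_col ?R"
  have "four_block_mat (A i) (B i) (C i) (D i) $$ (a, b) =
      (if a < r then if b < c then A i $$ (a, b) else B i $$ (a, b - c)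
       else if b < c then C i $$ (a - r, b) else D i $$ (a - r, b - c))" if "i < k" for i
    using ab carrier_matD[OF assms(1)[OF that]] carrier_matD[OF assms(4)[OF that]] by simp
  then show "?L $$ (a, b) = ?R $$ (a, b)"
    using ab by auto
qed auto

definition hcat :: "'a mat \<Rightarrow> 'a mat \<Rightarrow> 'a mat" where
  "hcat V W = mat (dim_row V) (dim_col V + dim_col W)
     (\<lambda>(a, b). if b < dim_col V then V $$ (a, b) else W $$ (a, b - dim_col V))"

lemma hcat_dim [simp]: "dim_row (hcat V W) = dim_row V" "dim_col (hcat V W) = dim_col V + dim_col W"
  by (auto simp: hcat_def)

lemma hcat_carrier [simp]:
  "V \<in> carrier_mat r c \<Longrightarrow> W \<in> carrier_mat r d \<Longrightarrow> hcat V W \<in> carrier_mat r (c + d)"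
  by (auto simp: hcat_def)

lemma hcat_index:
  "a < dim_row V \<Longrightarrow> b < dim_col V + dim_col W \<Longrightarrow>
    hcat V W $$ (a, b) = (if b < dim_col V then V $$ (a, b) else W $$ (a, b - dim_col V))"
  by (simp add: hcat_def)

lemma adjoint_hcat_mult_hcat:
  fixes V W V' W' :: "'a::conjugatable_field mat"
  assumes "dim_row W = dim_row V" "dim_row V' = dim_row V" "dim_row W' = dim_row V"
  shows "(hcat V W)\<^sup>\<dagger> * hcat V' W' =
    four_block_mat (V\<^sup>\<dagger> * V') (V\<^sup>\<dagger> * W') (W\<^sup>\<dagger> * V') (W\<^sup>\<dagger> * W')" (is "?L = ?R")
proof (rule eq_matI)
  fix a b assume "a < dim_row ?R" "b < dim_col ?R"
  then have ab: "a < dim_col V + dim_col W" "b < dim_col V' + dim_col W'"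
    by auto
  then show "?L $$ (a, b) = ?R $$ (a, b)"
    using assms by (auto simp: mult_index hcat_index simp del: index_mult_mat(1))
qed auto

lemma mult_hcat:
  fixes M V W :: "'a::semiring_0 mat"
  assumes "dim_col M = dim_row V" "dim_row W = dim_row V"
  shows "M * hcat V W = hcat (M * V) (M * W)" (is "?L = ?R")
proof (rule eq_matI)
  fix a b assume "a < dim_row ?R" "b < dim_col ?R"
  then show "?L $$ (a, b) = ?R $$ (a, b)"
    using assms by (auto simp: mult_index hcat_index simp del: index_mult_mat(1))
qed auto

lemma adjoint_hcat_mult_mult_hcat:
  fixes M V W :: "'a::conjugatable_field mat"
  assumes "M \<in> carrier_mat r r" "dim_row V = r" "dim_row W = r"
  shows "(hcat V W)\<^sup>\<dagger> * M * hcat V W = four_block_mat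
    (V\<^sup>\<dagger> * M * V) (V\<^sup>\<dagger> * M * W) (W\<^sup>\<dagger> * M * V) (W\<^sup>\<dagger> * M * W)"
proof -
  note d = assms(2,3) carrier_matD[OF assms(1)]
  have "(hcat V W)\<^sup>\<dagger> * M * hcat V W = (hcat V W)\<^sup>\<dagger> * hcat (M * V) (M * W)"
    using d by (simp add: mult_assoc_dim mult_hcat[of M])
  also have "\<dots> = four_block_mat
      (V\<^sup>\<dagger> * (M * V)) (V\<^sup>\<dagger> * (M * W)) (W\<^sup>\<dagger> * (M * V)) (W\<^sup>\<dagger> * (M * W))"
    using d by (simp add: adjoint_hcat_mult_hcat)
  finally show ?thesis
    using d by (simp add: mult_assoc_dim)
qed

lemma four_block_one:
  "four_block_mat (1\<^sub>m n) (0\<^sub>m n m) (0\<^sub>m m n) (1\<^sub>m m) = 1\<^sub>m (n + m)"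
  by simp

section \<open>Isometries\<close>

lemma mat_trace_one: "mat_trace (1\<^sub>m n :: 'a::semiring_1 mat) = of_nat n"
  by (simp add: mat_trace_def)

lemma mat_trace_minus:
  fixes A B :: "'a::ab_group_add mat"
  assumes "A \<in> carrier_mat n n" "B \<in> carrier_mat n n"
  shows "mat_trace (A - B) = mat_trace A - mat_trace B"
  using assms by (auto simp: mat_trace_def sum_subtractf)

lemma of_nat_nonneg_conjugatable: "0 \<le> (of_nat n :: 'a::conjugatable_ordered_field)"
proof -
  have "0 \<le> (1::'a)"
    using conjugate_square_positive[of "1::'a"] by simp
  then show ?thesis
    by (induction n) (auto intro: add_nonneg_nonneg)
qed

text \<open>
  The order of the field need not be total, but sums of ones are nonnegative in it. If \<open>N < n\<close>, the
  difference is the negative of such a sum; being nonnegative too, the sum would vanish, and with it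
  each of its terms.
\<close>

lemma of_nat_le_imp_le_conjugatable:
  assumes "0 \<le> (of_nat N - of_nat n :: 'a::conjugatable_ordered_field)"
  shows "n \<le> N"
proof (rule ccontr)
  assume "\<not> n \<le> N"
  then obtain d where n: "n = N + Suc d"
    by (metis add_Suc_right less_imp_Suc_add not_le)
  let ?x = "of_nat (Suc d) :: 'a"
  have "0 \<le> - ?x"
    using assms by (simp add: n)
  then have "?x + 0 \<le> ?x + - ?x"
    by (rule add_left_mono)
  then have "?x \<le> 0" by simp
  then have x0: "1 + (of_nat d :: 'a) = 0"
    using of_nat_nonneg_conjugatable[of "Suc d", where 'a='a] by simp
  have "1 + 0 \<le> 1 + (of_nat d :: 'a)"
    by (rule add_left_mono) (rule of_nat_nonneg_conjugatable)
  then have "(1::'a) \<le> 0" using x0 by simp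
  moreover have "0 \<le> (1::'a)" using of_nat_nonneg_conjugatable[of 1, where 'a='a] by simp
  ultimately show False
    by (metis antisym zero_neq_one)
qed

text \<open>
  The projection \<open>1 - V * V\<^sup>\<dagger>\<close> onto the complement of the range of an isometry has
  trace \<open>N - n\<close>, and it is its own Gram matrix.
\<close>

lemma isometry_dim_le:
  fixes V :: "'a::conjugatable_ordered_field mat"
  assumes V: "V \<in> carrier_mat N n" and iso: "V\<^sup>\<dagger> * V = 1\<^sub>m n"
  shows "n \<le> N"
proof -
  note d = carrier_matD[OF V]
  define P where "P = 1\<^sub>m N - V * V\<^sup>\<dagger>"
  have PP: "P\<^sup>\<dagger> * P = P"
  proof -
    have "V * V\<^sup>\<dagger> * (V * V\<^sup>\<dagger>) = V * (V\<^sup>\<dagger> * V) * V\<^sup>\<dagger>"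
      using d by (simp add: mult_assoc_dim)
    then have "V * V\<^sup>\<dagger> * (V * V\<^sup>\<dagger>) = V * V\<^sup>\<dagger>"
      using d by (simp add: iso)
    moreover have "P\<^sup>\<dagger> = P"
      using d by (simp add: P_def adjoint_minus adjoint_mult)
    moreover have "P * P = P - (V * V\<^sup>\<dagger> - V * V\<^sup>\<dagger> * (V * V\<^sup>\<dagger>))"
      using d by (simp add: P_def mult_minus_dim minus_mult_dim)
    moreover have "V * V\<^sup>\<dagger> \<in> carrier_mat N N" "P \<in> carrier_mat N N"
      using V by (auto simp: P_def)
    ultimately show ?thesis
      using d by auto
  qed
  have "mat_trace P = of_nat N - mat_trace (V * V\<^sup>\<dagger>)"
    using V by (simp add: P_def mat_trace_minus[of _ N] mat_trace_one)
  also have "mat_trace (V * V\<^sup>\<dagger>) = of_nat n"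
    using mat_trace_comm[OF V mat_adjoint_carrier[OF V]] by (simp add: iso mat_trace_one)
  finally have "0 \<le> (of_nat N - of_nat n :: 'a)"
    using mat_trace_gram_nonneg[of P] PP by simp
  then show ?thesis
    by (rule of_nat_le_imp_le_conjugatable)
qed

lemma square_isometry_right_inverse:
  fixes V :: "'a::conjugatable_field mat"
  assumes "V \<in> carrier_mat n n" "V\<^sup>\<dagger> * V = 1\<^sub>m n"
  shows "V * V\<^sup>\<dagger> = 1\<^sub>m n"
  using mat_mult_left_right_inverse[of "V\<^sup>\<dagger>" n V] assms by simp

text \<open>
  Square roots normalize vectors, and eigenvectors of self-adjoint matrices produce reducing
  subspaces. The real and the complex numbers have both, the rationals have neither.
\<close>

locale spectral_field =
  fixes field_type :: "'a::conjugatable_ordered_field itself"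
  assumes sqrt_ex: "0 \<le> (a::'a) \<Longrightarrow> \<exists>s. conjugate s * s = a"
    and eigenvector_ex: "(A::'a mat) \<in> carrier_mat n n \<Longrightarrow> A\<^sup>\<dagger> = A \<Longrightarrow> 0 < n \<Longrightarrow>
      \<exists>v\<in>carrier_mat n 1. \<exists>c. v \<noteq> 0\<^sub>m n 1 \<and> A * v = c \<cdot>\<^sub>m v"
begin

lemma inverse_sqrt_ex:
  fixes a :: 'a
  assumes "0 \<le> a" "a \<noteq> 0"
  shows "\<exists>c. c \<noteq> 0 \<and> conjugate c * c * a = 1"
proof -
  obtain s where s: "conjugate s * s = a"
    using sqrt_ex assms by blast
  then have s0: "s \<noteq> 0" "conjugate s \<noteq> 0"
    using assms by auto
  have "conjugate (inverse s) * inverse s * a = (inverse (conjugate s) * conjugate s) * (inverse s * s)"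
    by (simp only: s[symmetric] conjugate_inverse mult_ac)
  also have "\<dots> = 1"
    using s0 by simp
  finally show ?thesis
    using s0 by (intro exI[of _ "inverse s"]) auto
qed

lemma gram_scalar_normalize:
  fixes v :: "'a mat"
  assumes v: "v \<in> carrier_mat N n" and gram: "v\<^sup>\<dagger> * v = a \<cdot>\<^sub>m 1\<^sub>m n"
    and nz: "v \<noteq> 0\<^sub>m N n"
  shows "\<exists>c. c \<noteq> 0 \<and> (c \<cdot>\<^sub>m v)\<^sup>\<dagger> * (c \<cdot>\<^sub>m v) = 1\<^sub>m n"
proof -
  have n: "0 < n"
  proof (rule ccontr)
    assume "\<not> 0 < n"
    then have "v = 0\<^sub>m N n"
      using v by (intro eq_matI) auto
    then show False using nz by simp
  qed
  have "(v\<^sup>\<dagger> * v) $$ (0, 0) = a"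
    using n by (simp add: gram)
  then have a: "a = (\<Sum>l<N. v $$ (l, 0) * conjugate (v $$ (l, 0)))"
    using gram_diagonal[OF v n] by simp
  then have "0 \<le> a"
    by (simp add: sum_nonneg conjugate_square_positive)
  have "a \<noteq> 0"
  proof
    assume "a = 0"
    then have "v\<^sup>\<dagger> * v = 0\<^sub>m n n"
      using gram by auto
    then show False
      using gram_eq_zero[OF v] nz by simp
  qed
  with \<open>0 \<le> a\<close> obtain c where c: "c \<noteq> 0" "conjugate c * c * a = 1"
    using inverse_sqrt_ex by blast
  have "(c \<cdot>\<^sub>m v)\<^sup>\<dagger> * (c \<cdot>\<^sub>m v) = c \<cdot>\<^sub>m (conjugate c \<cdot>\<^sub>m (v\<^sup>\<dagger> * v))"
    by (simp add: adjoint_smult smult_mult_dim mult_smult_dim)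
  also have "\<dots> = (conjugate c * c * a) \<cdot>\<^sub>m 1\<^sub>m n"
    by (rule eq_matI) (auto simp: gram)
  also have "conjugate c * c * a = 1"
    by (rule c(2))
  also have "(1::'a) \<cdot>\<^sub>m 1\<^sub>m n = 1\<^sub>m n"
    by (rule eq_matI) auto
  finally show ?thesis
    using c(1) by (intro exI[of _ c]) auto
qed

lemma normalize_column:
  fixes v :: "'a mat"
  assumes v: "v \<in> carrier_mat N 1" and nz: "v \<noteq> 0\<^sub>m N 1"
  shows "\<exists>c. c \<noteq> 0 \<and> (c \<cdot>\<^sub>m v)\<^sup>\<dagger> * (c \<cdot>\<^sub>m v) = 1\<^sub>m 1"
proof (rule gram_scalar_normalize[OF v _ nz])
  show "v\<^sup>\<dagger> * v = ((v\<^sup>\<dagger> * v) $$ (0, 0)) \<cdot>\<^sub>m 1\<^sub>m 1"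
    using v by (intro eq_matI) auto
qed

text \<open>
  An orthonormal basis of a kernel: an orthonormal family in the kernel that cannot be enlarged spans
  it, since a vector outside the span could be projected off the family, normalized and added to it.
\<close>

lemma kernel_isometry:
  fixes Q :: "'a mat"
  assumes Q: "Q \<in> carrier_mat m N"
  shows "\<exists>d. \<exists>V\<in>carrier_mat N d. V\<^sup>\<dagger> * V = 1\<^sub>m d \<and> Q * V = 0\<^sub>m m d \<and>
    (\<forall>p. \<forall>X\<in>carrier_mat N p. Q * X = 0\<^sub>m m p \<longrightarrow> V * (V\<^sup>\<dagger> * X) = X)"
proof -
  define isos where
    "isos d \<longleftrightarrow> (\<exists>V\<in>carrier_mat N d. V\<^sup>\<dagger> * V = 1\<^sub>m d \<and> Q * V = 0\<^sub>m m d)" for d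
  have bound: "d \<le> N" if "isos d" for d
    using that isometry_dim_le unfolding isos_def by blast
  have "isos 0"
    unfolding isos_def using Q by (intro bexI[of _ "0\<^sub>m N 0"]) (auto intro!: eq_matI)
  then obtain d where d: "isos d" and max: "\<And>d'. isos d' \<Longrightarrow> d' \<le> d"
    using Nat.ex_has_greatest_nat[of isos 0 N] bound by blast
  \<comment> \<open>a longest orthonormal family of columns in the kernel\<close>
  obtain V where V: "V \<in> carrier_mat N d" and iso: "V\<^sup>\<dagger> * V = 1\<^sub>m d" and QV: "Q * V = 0\<^sub>m m d"
    using d unfolding isos_def by blast
  note dims = carrier_matD[OF V] carrier_matD[OF Q]
  have col: "V * (V\<^sup>\<dagger> * w) = w" if w: "w \<in> carrier_mat N 1" and Qw: "Q * w = 0\<^sub>m m 1" for w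
  proof (rule ccontr)
    assume ne: "V * (V\<^sup>\<dagger> * w) \<noteq> w"
    have VVw: "V * (V\<^sup>\<dagger> * w) \<in> carrier_mat N 1"
      using V w by (intro mult_carrier_mat[of _ N d]) auto
    define u where "u = w - V * (V\<^sup>\<dagger> * w)"
    have u: "u \<in> carrier_mat N 1"
      using V w by (auto simp: u_def)
    have "u \<noteq> 0\<^sub>m N 1"
      using ne minus_eq_zero_mat[OF _ w VVw] by (auto simp: u_def)
    then obtain c where c: "(c \<cdot>\<^sub>m u)\<^sup>\<dagger> * (c \<cdot>\<^sub>m u) = 1\<^sub>m 1"
      using normalize_column[OF u] by blast
    have VV: "V\<^sup>\<dagger> * (V * (V\<^sup>\<dagger> * w)) = V\<^sup>\<dagger> * w"
    proof -
      have "V\<^sup>\<dagger> * (V * (V\<^sup>\<dagger> * w)) = (V\<^sup>\<dagger> * V) * (V\<^sup>\<dagger> * w)"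
        using dims carrier_matD[OF w] by (simp add: mult_assoc_dim)
      then show ?thesis using dims by (simp add: iso)
    qed
    have QVV: "Q * (V * (V\<^sup>\<dagger> * w)) = 0\<^sub>m m 1"
    proof -
      have "Q * (V * (V\<^sup>\<dagger> * w)) = (Q * V) * (V\<^sup>\<dagger> * w)"
        using dims carrier_matD[OF w] by (simp add: mult_assoc_dim)
      then show ?thesis using dims carrier_matD[OF w] by (simp add: QV)
    qed
    have Vu: "V\<^sup>\<dagger> * u = 0\<^sub>m d 1"
      using dims carrier_matD[OF w] V w
      by (simp add: u_def mult_minus_dim VV)
    have Qu: "Q * u = 0\<^sub>m m 1"
      using dims carrier_matD[OF w]
      by (simp add: u_def mult_minus_dim QVV Qw)
    define U where "U = hcat V (c \<cdot>\<^sub>m u)"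
    have U: "U \<in> carrier_mat N (d + 1)"
      unfolding U_def using V u by (intro hcat_carrier) auto
    have uV: "u\<^sup>\<dagger> * V = 0\<^sub>m 1 d"
      using arg_cong[OF Vu, of mat_adjoint] dims carrier_matD[OF u] by (simp add: adjoint_mult)
    have "U\<^sup>\<dagger> * U = 1\<^sub>m (d + 1)"
      using dims carrier_matD[OF u] c
      by (simp add: U_def adjoint_hcat_mult_hcat iso mult_smult_dim smult_mult_dim adjoint_smult
          Vu uV)
    moreover have "Q * U = 0\<^sub>m m (d + 1)"
      using dims carrier_matD[OF u]
      by (auto simp: U_def mult_hcat QV mult_smult_dim Qu hcat_index intro!: eq_matI)
    ultimately have "isos (d + 1)"
      using U unfolding isos_def by blast
    then show False using max by fastforce
  qed
  have "V * (V\<^sup>\<dagger> * X) = X" if X: "X \<in> carrier_mat N p" and QX: "Q * X = 0\<^sub>m m p" for p X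
  proof (rule eq_mat_columnwise)
    fix j assume j: "j < p"
    have "Q * (X * unit_col p j) = Q * X * unit_col p j"
      using dims carrier_matD[OF X] by (simp add: mult_assoc_dim)
    then have "Q * (X * unit_col p j) = 0\<^sub>m m 1"
      by (simp add: QX)
    from col[OF mult_carrier_mat[OF X unit_col_carrier(1)] this]
    show "V * (V\<^sup>\<dagger> * X) * unit_col p j = X * unit_col p j"
      using dims carrier_matD[OF X] by (simp add: mult_assoc_dim)
  qed (use V X in auto)
  then show ?thesis
    using V iso QV by blast
qed

text \<open>
  The kernel of \<open>V\<^sup>\<dagger>\<close> is the orthogonal complement of the range of \<open>V\<close>; that an orthonormal basis of
  it has \<open>N - n\<close> members is read off from the trace of \<open>V * V\<^sup>\<dagger> + W * W\<^sup>\<dagger> = 1\<close>.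
\<close>

lemma isometry_complement:
  fixes V :: "'a mat"
  assumes V: "V \<in> carrier_mat N n" and iso: "V\<^sup>\<dagger> * V = 1\<^sub>m n"
  shows "\<exists>W\<in>carrier_mat N (N - n). W\<^sup>\<dagger> * W = 1\<^sub>m (N - n) \<and> V\<^sup>\<dagger> * W = 0\<^sub>m n (N - n) \<and>
    V * V\<^sup>\<dagger> + W * W\<^sup>\<dagger> = 1\<^sub>m N"
proof -
  obtain d W where W: "W \<in> carrier_mat N d" and isoW: "W\<^sup>\<dagger> * W = 1\<^sub>m d"
    and VW: "V\<^sup>\<dagger> * W = 0\<^sub>m n d"
    and span: "\<And>p X. X \<in> carrier_mat N p \<Longrightarrow> V\<^sup>\<dagger> * X = 0\<^sub>m n p \<Longrightarrow> W * (W\<^sup>\<dagger> * X) = X"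
    using kernel_isometry[OF mat_adjoint_carrier[OF V]] by metis
  note dims = carrier_matD[OF V] carrier_matD[OF W]
  define P where "P = 1\<^sub>m N - V * V\<^sup>\<dagger>"
  have P: "P \<in> carrier_mat N N"
    using V by (auto simp: P_def)
  have "V\<^sup>\<dagger> * (V * V\<^sup>\<dagger>) = (V\<^sup>\<dagger> * V) * V\<^sup>\<dagger>"
    using dims by (simp add: mult_assoc_dim)
  then have "V\<^sup>\<dagger> * P = 0\<^sub>m n N"
    using dims V
    by (simp add: P_def mult_minus_dim iso)
  then have WP: "W * (W\<^sup>\<dagger> * P) = P"
    by (rule span[OF P])
  have WV: "W\<^sup>\<dagger> * V = 0\<^sub>m d n"
    using arg_cong[OF VW, of mat_adjoint] dims by (simp add: adjoint_mult)
  have "W\<^sup>\<dagger> * (V * V\<^sup>\<dagger>) = (W\<^sup>\<dagger> * V) * V\<^sup>\<dagger>"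
    using dims by (simp add: mult_assoc_dim)
  then have "W\<^sup>\<dagger> * P = W\<^sup>\<dagger>"
    using dims W by (auto simp: P_def mult_minus_dim WV intro!: eq_matI)
  then have "V * V\<^sup>\<dagger> + W * W\<^sup>\<dagger> = V * V\<^sup>\<dagger> + (1\<^sub>m N - V * V\<^sup>\<dagger>)"
    using WP by (simp add: P_def)
  then have sum: "V * V\<^sup>\<dagger> + W * W\<^sup>\<dagger> = 1\<^sub>m N"
    using V by (simp add: add_diff_cancel_mat[of _ N N])
  have U: "hcat V W \<in> carrier_mat N (n + d)"
    using V W by simp
  have UU: "(hcat V W)\<^sup>\<dagger> * hcat V W = 1\<^sub>m (n + d)"
    using dims by (simp add: adjoint_hcat_mult_hcat iso isoW VW WV)
  have le: "n + d \<le> N"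
    using isometry_dim_le[OF U UU] .
  have "mat_trace (1\<^sub>m N :: 'a mat) = mat_trace (V * V\<^sup>\<dagger>) + mat_trace (W * W\<^sup>\<dagger>)"
    using V W by (simp add: sum[symmetric] mat_trace_def sum.distrib del: index_mult_mat(1))
  also have "\<dots> = of_nat (n + d)"
    using mat_trace_comm[OF V mat_adjoint_carrier[OF V]]
      mat_trace_comm[OF W mat_adjoint_carrier[OF W]] by (simp add: iso isoW mat_trace_one)
  finally have "(0::'a) \<le> of_nat (n + d) - of_nat N"
    by (simp add: mat_trace_one)
  then have "N \<le> n + d"
    by (rule of_nat_le_imp_le_conjugatable)
  with le have "d = N - n" by simp
  then show ?thesis
    using W isoW VW sum by blast
qed

end

section \<open>Matrix convex combinations\<close>

lemma SMnD:
  assumes "X \<in> SMn n"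
  shows "X j \<in> carrier_mat n n" "(X j)\<^sup>\<dagger> = X j" "dim_row (X j) = n" "dim_col (X j) = n"
  using assms by (auto simp: SMn_def)

lemma SMn_unique: "X \<in> SMn n \<Longrightarrow> X \<in> SMn m \<Longrightarrow> n = m"
  using SMnD(3) by metis

lemma SMn_compress:
  assumes "Y \<in> SMn N" "V \<in> carrier_mat N n"
  shows "(\<lambda>j. V\<^sup>\<dagger> * Y j * V) \<in> SMn n"
  using assms(2) SMnD[OF assms(1)] carrier_matD[OF assms(2)]
  by (auto simp: SMn_def adjoint_mult mult_assoc_dim)

lemma SMn_mat_sum:
  assumes "\<And>i. i < k \<Longrightarrow> Y i \<in> SMn n"
  shows "(\<lambda>j. mat_sum n n k (\<lambda>i. Y i j)) \<in> SMn n"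
proof -
  have "(mat_sum n n k (\<lambda>i. Y i j))\<^sup>\<dagger> = mat_sum n n k (\<lambda>i. Y i j)" for j
    using SMnD[OF assms] by (subst adjoint_mat_sum) (auto intro!: mat_sum_cong)
  then show ?thesis
    by (simp add: SMn_def)
qed

lemma SM_memD:
  assumes "K \<subseteq> SM" "X \<in> K"
  obtains n where "1 \<le> n" "X \<in> SMn n"
  using assms by (auto simp: SM_def)

lemma SM_size_ge_1: "K \<subseteq> SM \<Longrightarrow> X \<in> K \<Longrightarrow> X \<in> SMn n \<Longrightarrow> 1 \<le> n"
  by (metis SM_memD SMn_unique)

lemma matrix_convex_combinationI:
  assumes "1 \<le> n" "\<And>i. i < k \<Longrightarrow> 1 \<le> N i" "\<And>i. i < k \<Longrightarrow> Y i \<in> SMn (N i)"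
    "\<And>i. i < k \<Longrightarrow> V i \<in> carrier_mat (N i) n"
    "mat_sum n n k (\<lambda>i. (V i)\<^sup>\<dagger> * V i) = 1\<^sub>m n"
    "\<And>j. X j = mat_sum n n k (\<lambda>i. (V i)\<^sup>\<dagger> * Y i j * V i)"
  shows "matrix_convex_combination n k N V Y X"
proof -
  have "X = (\<lambda>j. mat_sum n n k (\<lambda>i. (V i)\<^sup>\<dagger> * Y i j * V i))"
    using assms(6) by auto
  then have "X \<in> SMn n"
    using SMn_mat_sum[of k "\<lambda>i j. (V i)\<^sup>\<dagger> * Y i j * V i" n] SMn_compress[OF assms(3,4)] by simp
  then show ?thesis
    using assms unfolding matrix_convex_combination_def by blast
qed

lemma matrix_convex_combinationD:
  assumes "matrix_convex_combination n k N V Y X"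
  shows "1 \<le> n" "X \<in> SMn n"
    "\<And>i. i < k \<Longrightarrow> 1 \<le> N i" "\<And>i. i < k \<Longrightarrow> Y i \<in> SMn (N i)"
    "\<And>i. i < k \<Longrightarrow> V i \<in> carrier_mat (N i) n"
    "mat_sum n n k (\<lambda>i. (V i)\<^sup>\<dagger> * V i) = 1\<^sub>m n"
    "\<And>j. X j = mat_sum n n k (\<lambda>i. (V i)\<^sup>\<dagger> * Y i j * V i)"
  using assms unfolding matrix_convex_combination_def by blast+

lemma compression_combination:
  assumes "Y \<in> SMn N" "V \<in> carrier_mat N n" "V\<^sup>\<dagger> * V = 1\<^sub>m n" "1 \<le> n" "1 \<le> N"
    and "\<And>j. X j = V\<^sup>\<dagger> * Y j * V"
  shows "matrix_convex_combination n 1 (\<lambda>_. N) (\<lambda>_. V) (\<lambda>_. Y) X"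
proof -
  have "V\<^sup>\<dagger> * Y j * V \<in> carrier_mat n n" for j
    using SMnD(1)[OF SMn_compress[OF assms(1,2)]] .
  then show ?thesis
    using assms by (intro matrix_convex_combinationI) (auto simp: mat_sum_1)
qed

lemma matrix_convexD:
  assumes "matrix_convex K"
  shows "K \<subseteq> SM"
    "matrix_convex_combination n k N V Y X \<Longrightarrow> (\<And>i. i < k \<Longrightarrow> Y i \<in> K) \<Longrightarrow> X \<in> K"
  using assms unfolding matrix_convex_def by blast+

lemma matrix_convex_compress:
  assumes "matrix_convex K" "Y \<in> K" "Y \<in> SMn N" "V \<in> carrier_mat N n" "V\<^sup>\<dagger> * V = 1\<^sub>m n" "1 \<le> n"
  shows "(\<lambda>j. V\<^sup>\<dagger> * Y j * V) \<in> K"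
proof (rule matrix_convexD(2)[OF assms(1) compression_combination[OF assms(3-6)]])
  show "1 \<le> N"
    using SM_size_ge_1[OF matrix_convexD(1)[OF assms(1)] assms(2,3)] .
qed (use assms in auto)

lemma free_extreme_points_subset: "free_extreme_points K \<subseteq> K"
  by (auto simp: free_extreme_points_def)

text \<open>
  Matrix convex combinations without the normalization \<open>\<Sum> V\<^sup>\<dagger> * V = 1\<close>; the sum is recorded in
  \<open>A\<close> instead. These can be added and compressed term by term, so that a combination of
  combinations is assembled one summand at a time.
\<close>

definition weighted_combination ::
  "('g::finite, 'a::conjugatable_field) mtuple set \<Rightarrow> nat \<Rightarrow> nat \<Rightarrow> 'a mat \<Rightarrow> ('g, 'a) mtuple \<Rightarrow> bool"
  where "weighted_combination E m p A X \<longleftrightarrow> (\<exists>k N V Y.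
     (\<forall>i<k. 1 \<le> N i \<and> Y i \<in> E \<and> Y i \<in> SMn (N i) \<and> V i \<in> carrier_mat (N i) p) \<and>
     A = mat_sum p p k (\<lambda>i. (V i)\<^sup>\<dagger> * V i) \<and>
     (\<forall>j. X j = mat_sum p p k (\<lambda>i. (V i)\<^sup>\<dagger> * Y i j * V i)) \<and> (\<Sum>i<k. N i) \<le> m)"

lemma weighted_combinationI:
  assumes "\<And>i. i < k \<Longrightarrow> 1 \<le> N i \<and> Y i \<in> E \<and> Y i \<in> SMn (N i) \<and> V i \<in> carrier_mat (N i) p"
    "A = mat_sum p p k (\<lambda>i. (V i)\<^sup>\<dagger> * V i)"
    "\<And>j. X j = mat_sum p p k (\<lambda>i. (V i)\<^sup>\<dagger> * Y i j * V i)" "(\<Sum>i<k. N i) \<le> m"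
  shows "weighted_combination E m p A X"
  unfolding weighted_combination_def
proof (rule exI[of _ k], rule exI[of _ N], rule exI[of _ V], rule exI[of _ Y], intro conjI)
  show "\<forall>i<k. 1 \<le> N i \<and> Y i \<in> E \<and> Y i \<in> SMn (N i) \<and> V i \<in> carrier_mat (N i) p"
    using assms(1) by blast
  show "\<forall>j. X j = mat_sum p p k (\<lambda>i. (V i)\<^sup>\<dagger> * Y i j * V i)"
    using assms(3) by (rule allI)
qed (fact assms(2) assms(4))+

lemma weighted_combinationE:
  assumes "weighted_combination E m p A X"
  obtains k N Y V where
    "\<forall>i<k. 1 \<le> N i \<and> Y i \<in> E \<and> Y i \<in> SMn (N i) \<and> V i \<in> carrier_mat (N i) p"
    "A = mat_sum p p k (\<lambda>i. (V i)\<^sup>\<dagger> * V i)"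
    "\<forall>j. X j = mat_sum p p k (\<lambda>i. (V i)\<^sup>\<dagger> * Y i j * V i)" "(\<Sum>i<k. N i) \<le> m"
  using assms unfolding weighted_combination_def by blast

lemma combination_iff_weighted:
  "combination_of_total_size_le E m X \<longleftrightarrow> (\<exists>n\<ge>1. weighted_combination E m n (1\<^sub>m n) X)"
proof
  assume "combination_of_total_size_le E m X"
  then obtain n k N V Y where comb: "matrix_convex_combination n k N V Y X"
    and E: "\<forall>i<k. Y i \<in> E" and m: "(\<Sum>i<k. N i) \<le> m"
    unfolding combination_of_total_size_le_def by blast
  note c = matrix_convex_combinationD[OF comb]
  have "weighted_combination E m n (1\<^sub>m n) X"
    by (rule weighted_combinationI[OF _ c(6)[symmetric] c(7) m]) (use c(3-5) E in blast)
  with c(1) show "\<exists>n\<ge>1. weighted_combination E m n (1\<^sub>m n) X"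
    by blast
next
  assume "\<exists>n\<ge>1. weighted_combination E m n (1\<^sub>m n) X"
  then obtain n where "1 \<le> n" and X: "weighted_combination E m n (1\<^sub>m n) X"
    by blast
  from X obtain k N Y V where
    Y: "\<forall>i<k. 1 \<le> N i \<and> Y i \<in> E \<and> Y i \<in> SMn (N i) \<and> V i \<in> carrier_mat (N i) n"
    and sum: "1\<^sub>m n = mat_sum n n k (\<lambda>i. (V i)\<^sup>\<dagger> * V i)"
      "\<forall>j. X j = mat_sum n n k (\<lambda>i. (V i)\<^sup>\<dagger> * Y i j * V i)" and m: "(\<Sum>i<k. N i) \<le> m"
    by (rule weighted_combinationE)
  have "matrix_convex_combination n k N V Y X"
    by (rule matrix_convex_combinationI[OF \<open>1 \<le> n\<close> _ _ _ sum(1)[symmetric] sum(2)[rule_format]])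
      (use Y in auto)
  with Y m show "combination_of_total_size_le E m X"
    unfolding combination_of_total_size_le_def by blast
qed

lemma matrix_convex_hull_iff:
  "X \<in> matrix_convex_hull E \<longleftrightarrow> (\<exists>m. combination_of_total_size_le E m X)"
  unfolding matrix_convex_hull_def combination_of_total_size_le_def by blast

lemma weighted_combination_size:
  assumes "weighted_combination E m p A X"
  shows "X \<in> SMn p"
proof -
  obtain k N V Y where
    Y: "\<forall>i<k. 1 \<le> N i \<and> Y i \<in> E \<and> Y i \<in> SMn (N i) \<and> V i \<in> carrier_mat (N i) p"
    and "A = mat_sum p p k (\<lambda>i. (V i)\<^sup>\<dagger> * V i)"
    and X: "\<forall>j. X j = mat_sum p p k (\<lambda>i. (V i)\<^sup>\<dagger> * Y i j * V i)" and "(\<Sum>i<k. N i) \<le> m"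
    using assms by (rule weighted_combinationE)
  note Y = Y[rule_format] and X = X[rule_format]
  then have "X = (\<lambda>j. mat_sum p p k (\<lambda>i. (V i)\<^sup>\<dagger> * Y i j * V i))"
    by auto
  then show ?thesis
    using SMn_mat_sum[of k "\<lambda>i j. (V i)\<^sup>\<dagger> * Y i j * V i" p] SMn_compress[of "Y i" "N i" "V i" p for i] Y
    by simp
qed

lemma combination_weighted:
  assumes "combination_of_total_size_le E m X" "X \<in> SMn n"
  shows "weighted_combination E m n (1\<^sub>m n) X"
  using assms weighted_combination_size SMn_unique unfolding combination_iff_weighted by metis

lemma weighted_combination_zero:
  "weighted_combination E m p (0\<^sub>m p p) (\<lambda>_. 0\<^sub>m p p)"
  by (rule weighted_combinationI[of 0]) auto

lemma weighted_combination_mono: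
  assumes "weighted_combination E m p A X" "m \<le> m'"
  shows "weighted_combination E m' p A X"
proof -
  obtain k N Y V where
    Y: "\<forall>i<k. 1 \<le> N i \<and> Y i \<in> E \<and> Y i \<in> SMn (N i) \<and> V i \<in> carrier_mat (N i) p"
    and A: "A = mat_sum p p k (\<lambda>i. (V i)\<^sup>\<dagger> * V i)"
    and X: "\<forall>j. X j = mat_sum p p k (\<lambda>i. (V i)\<^sup>\<dagger> * Y i j * V i)" and m: "(\<Sum>i<k. N i) \<le> m"
    using assms(1) by (rule weighted_combinationE)
  show ?thesis
    by (rule weighted_combinationI[OF _ A X[rule_format] order_trans[OF m assms(2)]]) (use Y in blast)
qed

lemma weighted_combination_add:
  assumes "weighted_combination E m p A X" "weighted_combination E m' p A' X'"
  shows "weighted_combination E (m + m') p (A + A') (\<lambda>j. X j + X' j)"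
proof -
  obtain k N V Y where
    Y: "\<forall>i<k. 1 \<le> N i \<and> Y i \<in> E \<and> Y i \<in> SMn (N i) \<and> V i \<in> carrier_mat (N i) p"
    and A: "A = mat_sum p p k (\<lambda>i. (V i)\<^sup>\<dagger> * V i)"
    and X: "\<forall>j. X j = mat_sum p p k (\<lambda>i. (V i)\<^sup>\<dagger> * Y i j * V i)" and m: "(\<Sum>i<k. N i) \<le> m"
    using assms(1) by (rule weighted_combinationE)
  note Y = Y[rule_format] and X = X[rule_format]
  obtain k' N' V' Y' where
    Y': "\<forall>i<k'. 1 \<le> N' i \<and> Y' i \<in> E \<and> Y' i \<in> SMn (N' i) \<and> V' i \<in> carrier_mat (N' i) p"
    and A': "A' = mat_sum p p k' (\<lambda>i. (V' i)\<^sup>\<dagger> * V' i)"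
    and X': "\<forall>j. X' j = mat_sum p p k' (\<lambda>i. (V' i)\<^sup>\<dagger> * Y' i j * V' i)" and m': "(\<Sum>i<k'. N' i) \<le> m'"
    using assms(2) by (rule weighted_combinationE)
  note Y' = Y'[rule_format] and X' = X'[rule_format]
  define N'' where "N'' i = (if i < k then N i else N' (i - k))" for i
  define V'' where "V'' i = (if i < k then V i else V' (i - k))" for i
  define Y'' where "Y'' i = (if i < k then Y i else Y' (i - k))" for i
  have "1 \<le> N'' i \<and> Y'' i \<in> E \<and> Y'' i \<in> SMn (N'' i) \<and> V'' i \<in> carrier_mat (N'' i) p"
    if "i < k + k'" for i
    using that Y Y' by (auto simp: N''_def V''_def Y''_def)
  moreover have "A + A' = mat_sum p p (k + k') (\<lambda>i. (V'' i)\<^sup>\<dagger> * V'' i)"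
    unfolding A A' mat_sum_append[symmetric] by (intro mat_sum_cong) (auto simp: V''_def)
  moreover have "X j + X' j = mat_sum p p (k + k') (\<lambda>i. (V'' i)\<^sup>\<dagger> * Y'' i j * V'' i)" for j
    unfolding X X' mat_sum_append[symmetric] by (intro mat_sum_cong) (auto simp: V''_def Y''_def)
  moreover have "(\<Sum>i<k + k'. N'' i) \<le> m + m'"
  proof -
    have "(\<Sum>i<k + k'. N'' i) = (\<Sum>i<k. N i) + (\<Sum>i<k'. N' i)"
      by (induction k') (auto simp: N''_def)
    with m m' show ?thesis by simp
  qed
  ultimately show ?thesis
    by (rule weighted_combinationI)
qed

lemma weighted_combination_compress:
  assumes "weighted_combination E m n A X" and P: "P \<in> carrier_mat n p"
  shows "weighted_combination E m p (P\<^sup>\<dagger> * A * P) (\<lambda>j. P\<^sup>\<dagger> * X j * P)"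
proof -
  obtain k N V Y where
    Y: "\<forall>i<k. 1 \<le> N i \<and> Y i \<in> E \<and> Y i \<in> SMn (N i) \<and> V i \<in> carrier_mat (N i) n"
    and A: "A = mat_sum n n k (\<lambda>i. (V i)\<^sup>\<dagger> * V i)"
    and X: "\<forall>j. X j = mat_sum n n k (\<lambda>i. (V i)\<^sup>\<dagger> * Y i j * V i)" and m: "(\<Sum>i<k. N i) \<le> m"
    using assms(1) by (rule weighted_combinationE)
  note Y = Y[rule_format] and X = X[rule_format]
  note Pd = carrier_matD[OF P]
  have Vd: "dim_row (V i) = N i" "dim_col (V i) = n" "dim_row (Y i j) = N i" "dim_col (Y i j) = N i"
    if "i < k" for i j
    using Y[OF that] SMnD(3,4)[of "Y i" "N i" j] by auto
  have c1: "(V i)\<^sup>\<dagger> * V i \<in> carrier_mat n n" "(V i)\<^sup>\<dagger> * Y i j * V i \<in> carrier_mat n n"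
    if "i < k" for i j
    by (rule carrier_matI; simp add: Vd[OF that])+
  have "P\<^sup>\<dagger> * A * P = mat_sum p p k (\<lambda>i. P\<^sup>\<dagger> * ((V i)\<^sup>\<dagger> * V i) * P)"
    unfolding A by (rule mult_mat_sum_mult[OF mat_adjoint_carrier[OF P] P c1(1)])
  also have "\<dots> = mat_sum p p k (\<lambda>i. (V i * P)\<^sup>\<dagger> * (V i * P))"
    using Vd Pd by (intro mat_sum_cong) (simp add: adjoint_mult mult_assoc_dim)
  finally have 1: "P\<^sup>\<dagger> * A * P = mat_sum p p k (\<lambda>i. (V i * P)\<^sup>\<dagger> * (V i * P))" .
  have 2: "P\<^sup>\<dagger> * X j * P = mat_sum p p k (\<lambda>i. (V i * P)\<^sup>\<dagger> * Y i j * (V i * P))" for j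
  proof -
    have "P\<^sup>\<dagger> * X j * P = mat_sum p p k (\<lambda>i. P\<^sup>\<dagger> * ((V i)\<^sup>\<dagger> * Y i j * V i) * P)"
      unfolding X by (rule mult_mat_sum_mult[OF mat_adjoint_carrier[OF P] P c1(2)])
    also have "\<dots> = mat_sum p p k (\<lambda>i. (V i * P)\<^sup>\<dagger> * Y i j * (V i * P))"
      using Vd Pd by (intro mat_sum_cong) (simp add: adjoint_mult mult_assoc_dim)
    finally show ?thesis .
  qed
  have "\<forall>i<k. 1 \<le> N i \<and> Y i \<in> E \<and> Y i \<in> SMn (N i) \<and> V i * P \<in> carrier_mat (N i) p"
    using Y mult_carrier_mat[OF _ P] by blast
  then show ?thesis
    by (intro weighted_combinationI[OF _ 1 2 m]) simp
qed

text \<open>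
  Substituting combinations of total size at most \<open>N i\<close> for the tuples \<open>Y i\<close> of size \<open>N i\<close> does not
  increase the total size.
\<close>

lemma combination_compose:
  assumes comb: "matrix_convex_combination n k N V Y X"
    and Y: "\<And>i. i < k \<Longrightarrow> combination_of_total_size_le E (N i) (Y i)"
    and m: "(\<Sum>i<k. N i) \<le> m"
  shows "combination_of_total_size_le E m X"
proof -
  note c = matrix_convex_combinationD[OF comb]
  have "weighted_combination E (\<Sum>i<l. N i) n (mat_sum n n l (\<lambda>i. (V i)\<^sup>\<dagger> * V i))
      (\<lambda>j. mat_sum n n l (\<lambda>i. (V i)\<^sup>\<dagger> * Y i j * V i))" if "l \<le> k" for l
    using that
  proof (induction l)
    case 0
    then show ?case by (simp add: weighted_combination_zero)
  next
    case (Suc l)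
    have V: "V l \<in> carrier_mat (N l) n" and Yl: "Y l \<in> SMn (N l)"
      using Suc.prems c by auto
    have "weighted_combination E (N l) (N l) (1\<^sub>m (N l)) (Y l)"
      using combination_weighted[OF Y Yl] Suc.prems by simp
    from weighted_combination_compress[OF this V]
    have "weighted_combination E (N l) n ((V l)\<^sup>\<dagger> * V l) (\<lambda>j. (V l)\<^sup>\<dagger> * Y l j * V l)"
      using V by simp
    from weighted_combination_add[OF Suc.IH this] Suc.prems
    show ?case
      using SMnD(1)[OF SMn_compress[OF Yl V]] mult_carrier_mat[OF mat_adjoint_carrier[OF V] V]
      by (simp add: mat_sum_Suc)
  qed
  from this[of k] have "weighted_combination E (\<Sum>i<k. N i) n (1\<^sub>m n) X"
    using c(6) by (simp flip: c(7))
  then have "weighted_combination E m n (1\<^sub>m n) X"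
    using m by (rule weighted_combination_mono)
  then show ?thesis
    using c(1) combination_iff_weighted by blast
qed

section \<open>Arveson extreme points\<close>

text \<open>
  A combination exhibits \<open>X\<close> as the compression of the direct sum of the \<open>Y i\<close> by the isometry with
  blocks \<open>V i\<close>, so the \<open>Y i\<close> dilate \<open>X\<close>. The dilation is trivial, that is, the range of the isometry
  reduces the direct sum, exactly if the isometry intertwines, which is the equation below. The usual
  definition asks this of dilations by one element of \<open>K\<close>; in terms of combinations it can be carried
  from one field to the other without forming direct sums.
\<close>

definition arveson_extreme ::
  "nat \<Rightarrow> ('g::finite, 'a::conjugatable_field) mtuple set \<Rightarrow> ('g, 'a) mtuple \<Rightarrow> bool" where
  "arveson_extreme n K X \<longleftrightarrow> X \<in> K \<and> X \<in> SMn n \<and>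
     (\<forall>k N V Y. matrix_convex_combination n k N V Y X \<longrightarrow> (\<forall>i<k. Y i \<in> K) \<longrightarrow>
        (\<forall>i<k. \<forall>j. Y i j * V i = V i * X j))"

lemma arveson_extremeD:
  assumes "arveson_extreme n K X"
  shows "X \<in> K" "X \<in> SMn n"
    "matrix_convex_combination n k N V Y X \<Longrightarrow> (\<And>i. i < k \<Longrightarrow> Y i \<in> K) \<Longrightarrow> i < k \<Longrightarrow>
      Y i j * V i = V i * X j"
  using assms unfolding arveson_extreme_def by blast+

lemma arveson_extremeI:
  assumes "X \<in> K" "X \<in> SMn n"
    "\<And>k N V Y i j. matrix_convex_combination n k N V Y X \<Longrightarrow> (\<And>i. i < k \<Longrightarrow> Y i \<in> K) \<Longrightarrow>
      i < k \<Longrightarrow> Y i j * V i = V i * X j"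
  shows "arveson_extreme n K X"
  using assms unfolding arveson_extreme_def by blast

section \<open>Free extreme points are Arveson extreme\<close>

lemma mat_trace_square_border:
  fixes A :: "'a::comm_ring_1 mat"
  assumes A: "A \<in> carrier_mat (Suc n) (Suc n)"
  shows "mat_trace (A * A) = (\<Sum>a<n. \<Sum>b<n. A $$ (a, b) * A $$ (b, a)) +
    ((\<Sum>a<n. A $$ (a, n) * A $$ (n, a)) + (\<Sum>a<n. A $$ (a, n) * A $$ (n, a))) +
    A $$ (n, n) * A $$ (n, n)"
proof -
  have "mat_trace (A * A) = (\<Sum>a<Suc n. \<Sum>b<Suc n. A $$ (a, b) * A $$ (b, a))"
    using carrier_matD[OF A] unfolding mat_trace_def
    by (auto simp: mult_index simp del: index_mult_mat(1) sum.lessThan_Suc intro!: sum.cong)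
  then show ?thesis
    by (simp add: sum.distrib mult.commute add_ac)
qed

text \<open>
  A border \<open>b\<close> adds \<open>2 * b\<^sup>\<dagger> * b\<close> to the trace of the square. The matrices \<open>M\<close> and \<open>D\<close> have equal
  traces, hence also equal last diagonal entries, and equal traces of their squares, so the border of
  \<open>M\<close> has as little weight as that of \<open>D\<close>, namely none.
\<close>

lemma border_zero_of_unitarily_equivalent:
  fixes M D :: "'a::conjugatable_ordered_field mat"
  assumes M: "M \<in> carrier_mat (Suc n) (Suc n)" "M\<^sup>\<dagger> = M"
    and D: "D \<in> carrier_mat (Suc n) (Suc n)" "\<And>a. a < n \<Longrightarrow> D $$ (a, n) = 0"
    and U: "unitary_mat (Suc n) U" and eq: "U\<^sup>\<dagger> * D * U = M"
    and corner: "\<And>a b. a < n \<Longrightarrow> b < n \<Longrightarrow> D $$ (a, b) = M $$ (a, b)"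
    and a: "a < n"
  shows "M $$ (a, n) = 0"
proof -
  have U: "U \<in> carrier_mat (Suc n) (Suc n)" "U * U\<^sup>\<dagger> = 1\<^sub>m (Suc n)"
    using U by (auto simp: unitary_mat_def)
  note d = carrier_matD[OF U(1)] carrier_matD[OF M(1)] carrier_matD[OF D(1)]
  have tr: "mat_trace (U\<^sup>\<dagger> * C * U) = mat_trace C" if C: "C \<in> carrier_mat (Suc n) (Suc n)" for C
  proof -
    have "mat_trace (U\<^sup>\<dagger> * (C * U)) = mat_trace (C * U * U\<^sup>\<dagger>)"
      using mat_trace_comm[of "U\<^sup>\<dagger>" "Suc n" "Suc n" "C * U"] U(1) C by simp
    then show ?thesis
      using d carrier_matD[OF C] by (simp add: mult_assoc_dim U)
  qed
  have "U\<^sup>\<dagger> * D * U * (U\<^sup>\<dagger> * D * U) = U\<^sup>\<dagger> * D * (U * U\<^sup>\<dagger>) * (D * U)"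
    using d by (simp add: mult_assoc_dim)
  also have "\<dots> = U\<^sup>\<dagger> * (D * D) * U"
    using d by (simp add: mult_assoc_dim U(2))
  finally have "M * M = U\<^sup>\<dagger> * (D * D) * U"
    by (simp add: eq)
  then have tr2: "mat_trace (M * M) = mat_trace (D * D)"
    using tr[of "D * D"] D by simp
  have "mat_trace M = mat_trace D"
    using tr[OF D(1)] by (simp add: eq)
  then have nn: "M $$ (n, n) = D $$ (n, n)"
    using d corner by (simp add: mat_trace_def)
  define t where "t = (\<Sum>a<n. M $$ (a, n) * M $$ (n, a))"
  have t: "t = (\<Sum>a<n. M $$ (a, n) * conjugate (M $$ (a, n)))"
    unfolding t_def
  proof (intro sum.cong refl)
    fix a assume "a \<in> {..<n}"
    then have "M $$ (n, a) = conjugate (M $$ (a, n))"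
      using d by (subst M(2)[symmetric]) simp
    then show "M $$ (a, n) * M $$ (n, a) = M $$ (a, n) * conjugate (M $$ (a, n))"
      by simp
  qed
  have tt: "t + t = 0"
    using tr2 unfolding mat_trace_square_border[OF M(1)] mat_trace_square_border[OF D(1)]
    by (simp add: t_def nn corner D(2))
  have t0: "0 \<le> t"
    unfolding t by (intro sum_nonneg) (simp add: conjugate_square_positive)
  then have "t + 0 \<le> t + t"
    by (rule add_left_mono)
  then have "t \<le> 0"
    unfolding tt by (simp only: add_0_right)
  with t0 have "t = 0"
    by (rule antisym[rotated])
  then have "M $$ (a, n) * conjugate (M $$ (a, n)) = 0"
    using a unfolding t by (subst (asm) sum_nonneg_eq_0_iff) (auto intro: conjugate_square_positive)
  then show ?thesis
    by simp
qed

lemma adjoint_corner_sandwich: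
  fixes M :: "'a::conjugatable_field mat"
  assumes M: "M \<in> carrier_mat (Suc n) (Suc n)"
  defines "E \<equiv> mat (Suc n) n (\<lambda>(a, b). if a = b then 1 else 0)"
  shows "E\<^sup>\<dagger> * M * E = mat n n (\<lambda>(a, b). M $$ (a, b))"
proof (rule eq_matI)
  fix a b assume "a < dim_row (mat n n (\<lambda>(a, b). M $$ (a, b)))"
    "b < dim_col (mat n n (\<lambda>(a, b). M $$ (a, b)))"
  then have ab: "a < n" "b < n" by auto
  have 1: "(E\<^sup>\<dagger> * M) $$ (a, l) = M $$ (a, l)" if "l < Suc n" for l
  proof -
    have "(E\<^sup>\<dagger> * M) $$ (a, l) = (\<Sum>i<Suc n. (if i = a then 1 else 0) * M $$ (i, l))"
      using that ab carrier_matD[OF M]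
      by (subst mult_index) (auto simp: E_def if_distrib cong: if_cong intro!: sum.cong)
    also have "\<dots> = M $$ (a, l)"
      using ab by (simp add: if_distrib[of "\<lambda>x. x * _"] sum.delta cong: if_cong)
    finally show ?thesis .
  qed
  have "(E\<^sup>\<dagger> * M * E) $$ (a, b) = (\<Sum>l<Suc n. M $$ (a, l) * (if l = b then 1 else 0))"
    using ab carrier_matD[OF M] 1
    by (subst mult_index) (auto simp: E_def intro!: sum.cong)
  also have "\<dots> = M $$ (a, b)"
    using ab by (simp add: if_distrib sum.delta cong: if_cong)
  finally show "(E\<^sup>\<dagger> * M * E) $$ (a, b) = mat n n (\<lambda>(a, b). M $$ (a, b)) $$ (a, b)"
    using ab by simp
qed (auto simp: E_def)

text \<open>
  The tuple \<open>M\<close> compresses to \<open>X\<close>, so free extremality of \<open>X\<close> makes it unitarily equivalent to the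
  direct sum of \<open>X\<close> and a tuple of size one.
\<close>

lemma free_extreme_border_zero:
  fixes K :: "('g::finite, 'a::conjugatable_ordered_field) mtuple set"
  assumes K: "matrix_convex K" and X: "X \<in> free_extreme_points K" "X \<in> SMn n"
    and M: "M \<in> K" "M \<in> SMn (Suc n)"
    and corner: "\<And>j a b. a < n \<Longrightarrow> b < n \<Longrightarrow> M j $$ (a, b) = X j $$ (a, b)"
    and a: "a < n"
  shows "M j $$ (a, n) = 0"
proof -
  define E :: "'a mat" where "E = mat (Suc n) n (\<lambda>(a, b). if a = b then 1 else 0)"
  have E: "E \<in> carrier_mat (Suc n) n" by (simp add: E_def)
  have n: "1 \<le> n" using a by simp
  have EE: "E\<^sup>\<dagger> * E = 1\<^sub>m n"
    using adjoint_corner_sandwich[of "1\<^sub>m (Suc n) :: 'a mat" n] carrier_matD[OF E]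
    by (auto simp: E_def[symmetric] intro!: eq_matI)
  have "X j = E\<^sup>\<dagger> * M j * E" for j
    using adjoint_corner_sandwich[OF SMnD(1)[OF M(2), of j]] corner SMnD[OF X(2), of j]
    by (auto simp: E_def[symmetric] intro!: eq_matI)
  then have comb: "matrix_convex_combination n 1 (\<lambda>_. Suc n) (\<lambda>_. E) (\<lambda>_. M) X"
    using compression_combination[OF M(2) E EE n] by simp
  have "E \<noteq> 0\<^sub>m (Suc n) n"
  proof
    assume "E = 0\<^sub>m (Suc n) n"
    then have "E $$ (0, 0) = 0" using n by simp
    then show False using n by (simp add: E_def)
  qed
  moreover obtain n' where n': "X \<in> SMn n'" and fe: "\<And>k N V Y. matrix_convex_combination n' k N V Y X \<and>
       (\<forall>i<k. Y i \<in> K \<and> V i \<noteq> 0\<^sub>m (N i) n') \<Longrightarrow>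
     (\<forall>i<k. (N i = n' \<and> unitarily_equivalent n' X (Y i)) \<or>
                (N i > n' \<and> (\<exists>Z \<in> K. unitarily_equivalent (N i) (direct_sum X Z) (Y i))))"
    using X(1) unfolding free_extreme_points_def by blast
  moreover have "n' = n"
    using n' X(2) SMn_unique by blast
  ultimately obtain Z where Z: "Z \<in> K" "unitarily_equivalent (Suc n) (direct_sum X Z) M"
    using fe[of 1 "\<lambda>_. Suc n" "\<lambda>_. E" "\<lambda>_. M"] comb M(1) by auto
  then obtain U where U: "unitary_mat (Suc n) U"
    and eq: "\<And>j. U\<^sup>\<dagger> * direct_sum X Z j * U = M j" and D: "direct_sum X Z \<in> SMn (Suc n)"
    unfolding unitarily_equivalent_def by blast
  obtain z where z: "Z \<in> SMn z"
    using Z(1) SM_memD[OF matrix_convexD(1)[OF K]] by blast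
  note dims = SMnD(3,4)[OF z, of j] SMnD(3,4)[OF X(2), of j]
  have "z = 1"
    using SMnD(3)[OF D, of j] dims by (simp add: direct_sum_def)
  then show ?thesis
    using dims corner a
    by (intro border_zero_of_unitarily_equivalent[OF SMnD(1,2)[OF M(2)] SMnD(1)[OF D] _ U eq])
      (auto simp: direct_sum_def)
qed

context spectral_field
begin

text \<open>
  The columns \<open>w i\<close> are orthogonal to the coefficients \<open>V i\<close>, so after scaling them to total norm
  one, the coefficients \<open>[V i | w i]\<close> give an element of \<open>K\<close> one size larger, with corner \<open>X\<close> and
  border \<open>\<Sum> (V i)\<^sup>\<dagger> * Y i * w i\<close>. Free extremality of \<open>X\<close> leaves no room for a border.
\<close>

lemma free_extreme_orthogonal_columns:
  fixes K :: "('g::finite, 'a) mtuple set"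
  assumes K: "matrix_convex K" and X: "X \<in> free_extreme_points K"
    and comb: "matrix_convex_combination n k N V Y X" and Y: "\<And>i. i < k \<Longrightarrow> Y i \<in> K"
    and w: "\<And>i. i < k \<Longrightarrow> w i \<in> carrier_mat (N i) 1"
    and orth: "mat_sum n 1 k (\<lambda>i. (V i)\<^sup>\<dagger> * w i) = 0\<^sub>m n 1"
  shows "mat_sum n 1 k (\<lambda>i. (V i)\<^sup>\<dagger> * Y i j * w i) = 0\<^sub>m n 1"
proof -
  note c = matrix_convex_combinationD[OF comb]
  have dims: "dim_row (V i) = N i" "dim_col (V i) = n" "dim_row (Y i j) = N i" "dim_col (Y i j) = N i"
    "dim_row (w i) = N i" "dim_col (w i) = 1" if "i < k" for i j
    using c(5)[OF that] SMnD(3,4)[OF c(4)[OF that]] w[OF that] by auto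
  have carr: "(V i)\<^sup>\<dagger> * V i \<in> carrier_mat n n" "(V i)\<^sup>\<dagger> * w i \<in> carrier_mat n 1"
    "(w i)\<^sup>\<dagger> * V i \<in> carrier_mat 1 n" "(w i)\<^sup>\<dagger> * w i \<in> carrier_mat 1 1"
    "(V i)\<^sup>\<dagger> * Y i j * V i \<in> carrier_mat n n" "(V i)\<^sup>\<dagger> * Y i j * w i \<in> carrier_mat n 1"
    "(w i)\<^sup>\<dagger> * Y i j * V i \<in> carrier_mat 1 n" "(w i)\<^sup>\<dagger> * Y i j * w i \<in> carrier_mat 1 1"
    if "i < k" for i j
    by (rule carrier_matI; simp add: dims[OF that])+
  \<comment> \<open>the bordered tuple is a matrix convex combination only if the columns have total norm one\<close>
  have normalized: "mat_sum n 1 k (\<lambda>i. (V i)\<^sup>\<dagger> * Y i j * u i) = 0\<^sub>m n 1"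
    if u: "\<And>i. i < k \<Longrightarrow> u i = c \<cdot>\<^sub>m w i" and one: "mat_sum 1 1 k (\<lambda>i. (u i)\<^sup>\<dagger> * u i) = 1\<^sub>m 1"
    for u c
  proof -
    have ud: "dim_row (u i) = N i" "dim_col (u i) = 1" if "i < k" for i
      using u[OF that] dims[OF that] by auto
    have carru: "(V i)\<^sup>\<dagger> * u i \<in> carrier_mat n 1"
      "(u i)\<^sup>\<dagger> * V i \<in> carrier_mat 1 n" "(u i)\<^sup>\<dagger> * u i \<in> carrier_mat 1 1"
      "(V i)\<^sup>\<dagger> * Y i j * u i \<in> carrier_mat n 1"
      "(u i)\<^sup>\<dagger> * Y i j * V i \<in> carrier_mat 1 n" "(u i)\<^sup>\<dagger> * Y i j * u i \<in> carrier_mat 1 1"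
      if "i < k" for i j
      by (rule carrier_matI; simp add: dims[OF that] ud[OF that])+
    define M where "M j = mat_sum (n + 1) (n + 1) k (\<lambda>i. (hcat (V i) (u i))\<^sup>\<dagger> * Y i j * hcat (V i) (u i))" for j
    have M_blocks: "M j = four_block_mat
        (X j) (mat_sum n 1 k (\<lambda>i. (V i)\<^sup>\<dagger> * Y i j * u i))
        (mat_sum 1 n k (\<lambda>i. (u i)\<^sup>\<dagger> * Y i j * V i)) (mat_sum 1 1 k (\<lambda>i. (u i)\<^sup>\<dagger> * Y i j * u i))" for j
    proof -
      have "M j = mat_sum (n + 1) (n + 1) k (\<lambda>i. four_block_mat
          ((V i)\<^sup>\<dagger> * Y i j * V i) ((V i)\<^sup>\<dagger> * Y i j * u i)
          ((u i)\<^sup>\<dagger> * Y i j * V i) ((u i)\<^sup>\<dagger> * Y i j * u i))"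
        unfolding M_def
        using dims ud SMnD(1)[OF c(4)]
        by (intro mat_sum_cong adjoint_hcat_mult_mult_hcat[where r = "N i" for i]) auto
      then show ?thesis
        using mat_sum_four_block[OF carr(5) carru(4-6)] c(7)[of j] by simp
    qed
    have Vu: "mat_sum n 1 k (\<lambda>i. (V i)\<^sup>\<dagger> * u i) = 0\<^sub>m n 1"
    proof -
      have "mat_sum n 1 k (\<lambda>i. (V i)\<^sup>\<dagger> * u i) = mat_sum n 1 k (\<lambda>i. (V i)\<^sup>\<dagger> * w i * (c \<cdot>\<^sub>m 1\<^sub>m 1))"
        using dims by (intro mat_sum_cong) (simp add: u mult_smult_dim)
      also have "\<dots> = mat_sum n 1 k (\<lambda>i. (V i)\<^sup>\<dagger> * w i) * (c \<cdot>\<^sub>m 1\<^sub>m 1)"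
        by (rule mat_sum_mult[symmetric]) (use carr(2) in auto)
      finally show ?thesis unfolding orth by simp
    qed
    have uV: "mat_sum 1 n k (\<lambda>i. (u i)\<^sup>\<dagger> * V i) = 0\<^sub>m 1 n"
    proof -
      have "mat_sum 1 n k (\<lambda>i. (u i)\<^sup>\<dagger> * V i) = mat_sum 1 n k (\<lambda>i. ((V i)\<^sup>\<dagger> * u i)\<^sup>\<dagger>)"
        using dims ud by (intro mat_sum_cong) (simp add: adjoint_mult)
      also have "\<dots> = (mat_sum n 1 k (\<lambda>i. (V i)\<^sup>\<dagger> * u i))\<^sup>\<dagger>"
        by (rule adjoint_mat_sum[symmetric]) (rule carru(1))
      finally show ?thesis unfolding Vu by simp
    qed
    have "mat_sum (n + 1) (n + 1) k (\<lambda>i. (hcat (V i) (u i))\<^sup>\<dagger> * hcat (V i) (u i)) =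
        mat_sum (n + 1) (n + 1) k (\<lambda>i. four_block_mat
          ((V i)\<^sup>\<dagger> * V i) ((V i)\<^sup>\<dagger> * u i) ((u i)\<^sup>\<dagger> * V i) ((u i)\<^sup>\<dagger> * u i))"
      using dims ud by (intro mat_sum_cong adjoint_hcat_mult_hcat) auto
    also have "\<dots> = four_block_mat
        (mat_sum n n k (\<lambda>i. (V i)\<^sup>\<dagger> * V i)) (mat_sum n 1 k (\<lambda>i. (V i)\<^sup>\<dagger> * u i))
        (mat_sum 1 n k (\<lambda>i. (u i)\<^sup>\<dagger> * V i)) (mat_sum 1 1 k (\<lambda>i. (u i)\<^sup>\<dagger> * u i))"
      by (intro mat_sum_four_block carr carru)
    also have "\<dots> = 1\<^sub>m (n + 1)"
      unfolding c(6) Vu uV one by (rule four_block_one)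
    finally have sum1: "mat_sum (n + 1) (n + 1) k (\<lambda>i. (hcat (V i) (u i))\<^sup>\<dagger> * hcat (V i) (u i)) = 1\<^sub>m (n + 1)" .
    have combM: "matrix_convex_combination (n + 1) k N (\<lambda>i. hcat (V i) (u i)) Y M"
    proof (rule matrix_convex_combinationI[OF _ c(3,4) _ sum1 M_def])
      fix i assume "i < k"
      then show "hcat (V i) (u i) \<in> carrier_mat (N i) (n + 1)"
        using dims ud by (intro hcat_carrier) auto
    qed auto
    have MK: "M \<in> K"
      using matrix_convexD(2)[OF K combM] Y by blast
    show ?thesis
    proof (rule eq_matI)
      fix a b assume "a < dim_row (0\<^sub>m n 1)" "b < dim_col (0\<^sub>m n 1 :: 'a mat)"
      then have ab: "a < n" "b = 0" by auto
      have "M j $$ (a, n) = 0"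
      proof (rule free_extreme_border_zero[OF K X c(2) MK _ _ ab(1)])
        show "M \<in> SMn (Suc n)"
          using matrix_convex_combinationD(2)[OF combM] by simp
        show "M j $$ (a, b) = X j $$ (a, b)" if "a < n" "b < n" for j a b
          using that SMnD(3,4)[OF c(2)] by (simp add: M_blocks)
      qed
      then show "mat_sum n 1 k (\<lambda>i. (V i)\<^sup>\<dagger> * Y i j * u i) $$ (a, b) = 0\<^sub>m n 1 $$ (a, b)"
        using ab SMnD(3,4)[OF c(2)] by (simp add: M_blocks)
    qed auto
  qed
  define s where "s = mat_sum 1 1 k (\<lambda>i. (w i)\<^sup>\<dagger> * w i) $$ (0, 0)"
  have s: "mat_sum 1 1 k (\<lambda>i. (w i)\<^sup>\<dagger> * w i) = s \<cdot>\<^sub>m 1\<^sub>m 1"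
    by (rule eq_matI) (auto simp: s_def)
  have s_eq: "s = (\<Sum>i<k. ((w i)\<^sup>\<dagger> * w i) $$ (0, 0))"
    by (simp add: s_def)
  have "0 \<le> s"
    unfolding s_eq
  proof (rule sum_nonneg)
    fix i assume "i \<in> {..<k}"
    then show "0 \<le> ((w i)\<^sup>\<dagger> * w i) $$ (0, 0)"
      using gram_diagonal[OF w, of i 0] by (simp add: sum_nonneg conjugate_square_positive)
  qed
  show ?thesis
  proof (cases "s = 0")
    case True
    then have "mat_sum 1 1 k (\<lambda>i. (w i)\<^sup>\<dagger> * w i) = 0\<^sub>m 1 1"
      using s by auto
    then have "w i = 0\<^sub>m (N i) 1" if "i < k" for i
      using mat_sum_gram_eq_zero[of k w N 1] w that by blast
    then have "mat_sum n 1 k (\<lambda>i. (V i)\<^sup>\<dagger> * Y i j * w i) = mat_sum n 1 k (\<lambda>i. 0\<^sub>m n 1)"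
      using dims by (intro mat_sum_cong) auto
    then show ?thesis
      by (auto intro!: eq_matI)
  next
    case False
    then obtain c where c0: "c \<noteq> 0" and cs: "conjugate c * c * s = 1"
      using inverse_sqrt_ex \<open>0 \<le> s\<close> by blast
    have "mat_sum 1 1 k (\<lambda>i. (c \<cdot>\<^sub>m w i)\<^sup>\<dagger> * (c \<cdot>\<^sub>m w i)) =
        mat_sum 1 1 k (\<lambda>i. (w i)\<^sup>\<dagger> * w i * ((conjugate c * c) \<cdot>\<^sub>m 1\<^sub>m 1))"
      using dims by (intro mat_sum_cong)
        (auto simp: adjoint_smult smult_mult_dim mult_smult_dim intro!: eq_matI)
    also have "\<dots> = mat_sum 1 1 k (\<lambda>i. (w i)\<^sup>\<dagger> * w i) * ((conjugate c * c) \<cdot>\<^sub>m 1\<^sub>m 1)"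
      by (rule mat_sum_mult[symmetric]) (use carr(4) in auto)
    also have "\<dots> = (conjugate c * c * s) \<cdot>\<^sub>m 1\<^sub>m 1"
      unfolding s by (auto simp: mult_smult_dim smult_mult_dim mult_ac intro!: eq_matI)
    also have "\<dots> = 1\<^sub>m 1"
      by (auto simp: cs)
    finally have 0: "mat_sum n 1 k (\<lambda>i. (V i)\<^sup>\<dagger> * Y i j * (c \<cdot>\<^sub>m w i)) = 0\<^sub>m n 1"
      by (rule normalized[OF refl])
    have "mat_sum n 1 k (\<lambda>i. (V i)\<^sup>\<dagger> * Y i j * w i) =
        mat_sum n 1 k (\<lambda>i. (V i)\<^sup>\<dagger> * Y i j * (c \<cdot>\<^sub>m w i) * (inverse c \<cdot>\<^sub>m 1\<^sub>m 1))"
      using dims c0 by (intro mat_sum_cong)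
        (auto simp: mult_smult_dim smult_mult_dim intro!: eq_matI)
    also have "\<dots> = mat_sum n 1 k (\<lambda>i. (V i)\<^sup>\<dagger> * Y i j * (c \<cdot>\<^sub>m w i)) * (inverse c \<cdot>\<^sub>m 1\<^sub>m 1)"
      using dims by (intro mat_sum_mult[symmetric]) (auto intro!: carrier_matI)
    finally show ?thesis
      unfolding 0 by simp
  qed
qed

text \<open>
  For \<open>T i = Y i * V i - V i * X\<close>, the sum \<open>\<Sum> (V i)\<^sup>\<dagger> * T i = X - X\<close> is zero. So the columns of the
  \<open>T i\<close> are orthogonal to the \<open>V i\<close>, which makes \<open>\<Sum> (V i)\<^sup>\<dagger> * Y i * T i\<close> zero as well, and
  \<open>\<Sum> (T i)\<^sup>\<dagger> * T i\<close> is the second of these sums minus \<open>X\<close> times the first.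
\<close>

lemma free_extreme_imp_arveson_extreme:
  fixes K :: "('g::finite, 'a) mtuple set"
  assumes K: "matrix_convex K" and X: "X \<in> free_extreme_points K" "X \<in> SMn n"
  shows "arveson_extreme n K X"
proof (rule arveson_extremeI)
  show "X \<in> K" using X(1) free_extreme_points_subset by blast
  show "X \<in> SMn n" by (rule X(2))
  fix k N V Y l j
  assume comb: "matrix_convex_combination n k N V Y X" and Y: "\<And>i. i < k \<Longrightarrow> Y i \<in> K" and l: "l < k"
  note c = matrix_convex_combinationD[OF comb]
  have dims: "dim_row (V i) = N i" "dim_col (V i) = n" "dim_row (Y i j) = N i" "dim_col (Y i j) = N i"
    "dim_row (X j) = n" "dim_col (X j) = n"
    if "i < k" for i
    using c(5)[OF that] SMnD(3,4)[OF c(4)[OF that]] SMnD(3,4)[OF X(2)] by auto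
  define T where "T i = Y i j * V i - V i * X j" for i
  have T: "T i \<in> carrier_mat (N i) n" if "i < k" for i
    unfolding T_def by (rule carrier_matI; simp add: dims[OF that])
  have Td: "dim_row (T i) = N i" "dim_col (T i) = n" if "i < k" for i
    using T[OF that] by auto
  have VT: "mat_sum n n k (\<lambda>i. (V i)\<^sup>\<dagger> * T i) = 0\<^sub>m n n"
  proof -
    have carr: "(V i)\<^sup>\<dagger> * Y i j * V i \<in> carrier_mat n n" "(V i)\<^sup>\<dagger> * V i * X j \<in> carrier_mat n n"
      "(V i)\<^sup>\<dagger> * V i \<in> carrier_mat n n" if "i < k" for i
      by (rule carrier_matI; simp add: dims[OF that])+
    have "mat_sum n n k (\<lambda>i. (V i)\<^sup>\<dagger> * T i) =
        mat_sum n n k (\<lambda>i. (V i)\<^sup>\<dagger> * Y i j * V i - (V i)\<^sup>\<dagger> * V i * X j)"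
      using dims by (intro mat_sum_cong) (simp add: T_def mult_minus_dim mult_assoc_dim)
    also have "\<dots> = X j - mat_sum n n k (\<lambda>i. (V i)\<^sup>\<dagger> * V i * X j)"
      using mat_sum_minus[OF carr(1,2)] c(7)[of j] by simp
    also have "mat_sum n n k (\<lambda>i. (V i)\<^sup>\<dagger> * V i * X j) = X j"
      using mat_sum_mult[OF SMnD(1)[OF X(2), of j], of k "\<lambda>i. (V i)\<^sup>\<dagger> * V i" n] carr(3) SMnD(3)[OF X(2)] by (simp add: c(6))
    finally show ?thesis
      using SMnD(3,4)[OF X(2)] by simp
  qed
  have VYT: "mat_sum n n k (\<lambda>i. (V i)\<^sup>\<dagger> * Y i j * T i) = 0\<^sub>m n n"
  proof (rule eq_mat_columnwise)
    fix b assume "b < n"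
    let ?e = "unit_col n b :: 'a mat"
    have w: "T i * ?e \<in> carrier_mat (N i) 1" if "i < k" for i
      using T[OF that] by (rule mult_carrier_mat) (rule unit_col_carrier(1))
    have "mat_sum n 1 k (\<lambda>i. (V i)\<^sup>\<dagger> * (T i * ?e)) = mat_sum n 1 k (\<lambda>i. (V i)\<^sup>\<dagger> * T i * ?e)"
      using dims Td by (intro mat_sum_cong) (simp add: mult_assoc_dim)
    also have "\<dots> = mat_sum n n k (\<lambda>i. (V i)\<^sup>\<dagger> * T i) * ?e"
      using dims Td by (intro mat_sum_mult[symmetric]) (auto intro!: carrier_matI)
    also have "\<dots> = 0\<^sub>m n 1"
      unfolding VT by simp
    finally have orth: "mat_sum n 1 k (\<lambda>i. (V i)\<^sup>\<dagger> * (T i * ?e)) = 0\<^sub>m n 1" .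
    have 0: "mat_sum n 1 k (\<lambda>i. (V i)\<^sup>\<dagger> * Y i j * (T i * ?e)) = 0\<^sub>m n 1"
      by (rule free_extreme_orthogonal_columns[where w = "\<lambda>i. T i * ?e", OF K X(1) comb Y w orth])
    have "mat_sum n n k (\<lambda>i. (V i)\<^sup>\<dagger> * Y i j * T i) * ?e =
        mat_sum n 1 k (\<lambda>i. (V i)\<^sup>\<dagger> * Y i j * T i * ?e)"
      using dims Td by (intro mat_sum_mult) (auto intro!: carrier_matI)
    also have "\<dots> = mat_sum n 1 k (\<lambda>i. (V i)\<^sup>\<dagger> * Y i j * (T i * ?e))"
      using dims Td by (intro mat_sum_cong) (simp add: mult_assoc_dim)
    finally show "mat_sum n n k (\<lambda>i. (V i)\<^sup>\<dagger> * Y i j * T i) * ?e = 0\<^sub>m n n * ?e"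
      unfolding 0 by simp
  qed auto
  have "mat_sum n n k (\<lambda>i. (T i)\<^sup>\<dagger> * T i) =
      mat_sum n n k (\<lambda>i. (V i)\<^sup>\<dagger> * Y i j * T i - X j * ((V i)\<^sup>\<dagger> * T i))"
  proof (intro mat_sum_cong)
    fix i assume i: "i < k"
    have "(T i)\<^sup>\<dagger> = (V i)\<^sup>\<dagger> * Y i j - X j * (V i)\<^sup>\<dagger>"
      using dims[OF i] SMnD(2)[OF c(4)[OF i]] SMnD(2)[OF X(2)]
      by (simp add: T_def adjoint_minus adjoint_mult)
    then show "(T i)\<^sup>\<dagger> * T i = (V i)\<^sup>\<dagger> * Y i j * T i - X j * ((V i)\<^sup>\<dagger> * T i)"
      using dims[OF i] Td[OF i] by (simp add: minus_mult_dim mult_assoc_dim)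
  qed
  also have "\<dots> = mat_sum n n k (\<lambda>i. (V i)\<^sup>\<dagger> * Y i j * T i) - mat_sum n n k (\<lambda>i. X j * ((V i)\<^sup>\<dagger> * T i))"
    using dims Td by (intro mat_sum_minus) (auto intro!: carrier_matI)
  also have "mat_sum n n k (\<lambda>i. X j * ((V i)\<^sup>\<dagger> * T i)) = X j * mat_sum n n k (\<lambda>i. (V i)\<^sup>\<dagger> * T i)"
    using dims Td SMnD(1)[OF X(2)] by (intro mult_mat_sum[symmetric]) (auto intro!: carrier_matI)
  finally have "mat_sum n n k (\<lambda>i. (T i)\<^sup>\<dagger> * T i) = 0\<^sub>m n n"
    using SMnD(3,4)[OF X(2)] by (simp add: VT VYT)
  then have "T l = 0\<^sub>m (N l) n"
    using mat_sum_gram_eq_zero[of k T N n l] T l by blast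
  then show "Y l j * V l = V l * X j"
    unfolding T_def by (rule minus_eq_zero_mat) (rule carrier_matI; simp add: dims[OF l])+
qed

end

section \<open>Splitting Arveson extreme points\<close>

lemma unitarily_equivalent_sym:
  assumes "unitarily_equivalent n X Y"
  shows "unitarily_equivalent n Y X"
proof -
  obtain U where U: "unitary_mat n U" "\<And>j. U\<^sup>\<dagger> * X j * U = Y j" and X: "X \<in> SMn n" and Y: "Y \<in> SMn n"
    using assms unfolding unitarily_equivalent_def by blast
  have Uc: "U \<in> carrier_mat n n" and UU: "U * U\<^sup>\<dagger> = 1\<^sub>m n"
    using U(1) by (auto simp: unitary_mat_def)
  note d = carrier_matD[OF Uc] SMnD(3,4)[OF X]
  have "(U\<^sup>\<dagger>)\<^sup>\<dagger> * Y j * U\<^sup>\<dagger> = X j" for j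
  proof -
    have "U * (U\<^sup>\<dagger> * X j * U) * U\<^sup>\<dagger> = (U * U\<^sup>\<dagger>) * X j * (U * U\<^sup>\<dagger>)"
      using d by (simp add: mult_assoc_dim)
    then show ?thesis
      using d by (simp add: UU U(2))
  qed
  moreover have "unitary_mat n (U\<^sup>\<dagger>)"
    using U(1) by (simp add: unitary_mat_def)
  ultimately show ?thesis
    using X Y unfolding unitarily_equivalent_def by blast
qed

text \<open>
  The range of \<open>u\<close> is invariant under the self-adjoint \<open>M\<close>, hence reduces it; on the range \<open>M\<close> is a
  copy of \<open>X\<close>, and its compression to the complement is in \<open>K\<close>.
\<close>

lemma (in spectral_field) intertwining_isometry_splits:
  fixes K :: "('g::finite, 'a) mtuple set"
  assumes K: "matrix_convex K" and X: "X \<in> SMn n" and M: "M \<in> K" "M \<in> SMn m"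
    and u: "u \<in> carrier_mat m n" "u\<^sup>\<dagger> * u = 1\<^sub>m n" and inter: "\<And>j. M j * u = u * X j"
  shows "(m = n \<and> unitarily_equivalent n X M) \<or>
    (m > n \<and> (\<exists>Z\<in>K. unitarily_equivalent m (direct_sum X Z) M))"
proof -
  obtain W where W: "W \<in> carrier_mat m (m - n)" "W\<^sup>\<dagger> * W = 1\<^sub>m (m - n)"
    and uW: "u\<^sup>\<dagger> * W = 0\<^sub>m n (m - n)"
    using isometry_complement[OF u] by blast
  have le: "n \<le> m"
    using isometry_dim_le[OF u] .
  note d = carrier_matD[OF u(1)] carrier_matD[OF W(1)] SMnD(3,4)[OF X] SMnD(3,4)[OF M(2)]
  have uMu: "u\<^sup>\<dagger> * M j * u = X j" for j
  proof -
    have "u\<^sup>\<dagger> * M j * u = u\<^sup>\<dagger> * u * X j"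
      using d by (simp add: mult_assoc_dim inter)
    then show ?thesis
      using d by (simp add: u(2))
  qed
  show ?thesis
  proof (cases "m = n")
    case True
    have "unitary_mat n u"
      using u square_isometry_right_inverse[of u n] True by (auto simp: unitary_mat_def)
    then have "unitarily_equivalent n M X"
      using uMu X M(2) True unfolding unitarily_equivalent_def by blast
    then show ?thesis
      using True unitarily_equivalent_sym by blast
  next
    case False
    with le have lt: "n < m" by simp
    define Z where "Z j = W\<^sup>\<dagger> * M j * W" for j
    have Z: "Z \<in> K" "Z \<in> SMn (m - n)"
      unfolding Z_def using matrix_convex_compress[OF K M W] SMn_compress[OF M(2) W(1)] lt by auto
    define U where "U = hcat u W"
    have U: "U \<in> carrier_mat m m"
      using hcat_carrier[OF u(1) W(1)] le by (simp add: U_def)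
    have Wu: "W\<^sup>\<dagger> * u = 0\<^sub>m (m - n) n"
      using arg_cong[OF uW, of mat_adjoint] d by (simp add: adjoint_mult)
    have "U\<^sup>\<dagger> * U = 1\<^sub>m m"
      unfolding U_def using d le by (simp add: adjoint_hcat_mult_hcat u(2) W(2) uW Wu)
    then have unit: "unitary_mat m U"
      using U square_isometry_right_inverse[OF U] by (simp add: unitary_mat_def)
    have UMU: "U\<^sup>\<dagger> * M j * U = direct_sum X Z j" for j
    proof -
      have WMu: "W\<^sup>\<dagger> * M j * u = 0\<^sub>m (m - n) n"
      proof -
        have "W\<^sup>\<dagger> * M j * u = W\<^sup>\<dagger> * u * X j"
          using d by (simp add: mult_assoc_dim inter)
        then show ?thesis
          using d by (simp add: Wu)
      qed
      have "u\<^sup>\<dagger> * M j * W = (W\<^sup>\<dagger> * M j * u)\<^sup>\<dagger>"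
        using d SMnD(2)[OF M(2)] by (simp add: adjoint_mult mult_assoc_dim)
      then have uMW: "u\<^sup>\<dagger> * M j * W = 0\<^sub>m n (m - n)"
        by (simp add: WMu)
      show ?thesis
        using adjoint_hcat_mult_mult_hcat[OF SMnD(1)[OF M(2)], of u W j] d SMnD(3,4)[OF Z(2)]
        by (simp add: U_def direct_sum_def uMu WMu uMW Z_def[symmetric])
    qed
    have "(\<lambda>j. U\<^sup>\<dagger> * M j * U) \<in> SMn m"
      by (rule SMn_compress[OF M(2) U])
    then have "unitarily_equivalent m M (direct_sum X Z)"
      using unit UMU M(2) unfolding unitarily_equivalent_def by auto
    then show ?thesis
      using Z(1) lt unitarily_equivalent_sym by blast
  qed
qed

context spectral_field
begin

text \<open>
  A combination for the summand \<open>Z\<close> becomes one for \<open>X\<close> when its coefficients are multiplied by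
  \<open>V\<^sup>\<dagger>\<close> and the other summand \<open>Z'\<close> is added to it with the coefficient \<open>W\<^sup>\<dagger>\<close>.
\<close>

lemma arveson_extreme_summand:
  fixes K :: "('g::finite, 'a) mtuple set"
  assumes X: "arveson_extreme n K X"
    and V: "V \<in> carrier_mat n d" "V\<^sup>\<dagger> * V = 1\<^sub>m d" and W: "W \<in> carrier_mat n e"
    and VW: "V * V\<^sup>\<dagger> + W * W\<^sup>\<dagger> = 1\<^sub>m n" and e: "1 \<le> e"
    and Z: "Z \<in> K" "Z \<in> SMn d" "\<And>j. X j * V = V * Z j"
    and Z': "Z' \<in> K" "Z' \<in> SMn e" "\<And>j. X j * W = W * Z' j"
  shows "arveson_extreme d K Z"
proof (rule arveson_extremeI[OF Z(1,2)])
  fix k N C Y l j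
  assume comb: "matrix_convex_combination d k N C Y Z" and Y: "\<And>i. i < k \<Longrightarrow> Y i \<in> K" and l: "l < k"
  note c = matrix_convex_combinationD[OF comb]
  note Xs = arveson_extremeD(2)[OF X]
  note vd = carrier_matD[OF V(1)] carrier_matD[OF W] SMnD(3,4)[OF Xs] SMnD(3,4)[OF Z(2)] SMnD(3,4)[OF Z'(2)]
  have dims: "dim_row (C i) = N i" "dim_col (C i) = d" "dim_row (Y i j) = N i" "dim_col (Y i j) = N i"
    if "i < k" for i j
    using c(5)[OF that] SMnD(3,4)[OF c(4)[OF that]] by auto
  have X_split: "X j = V * Z j * V\<^sup>\<dagger> + W * Z' j * W\<^sup>\<dagger>" for j
  proof -
    have "X j = X j * (V * V\<^sup>\<dagger> + W * W\<^sup>\<dagger>)"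
      using vd by (simp add: VW)
    also have "\<dots> = X j * V * V\<^sup>\<dagger> + X j * W * W\<^sup>\<dagger>"
      using vd by (simp add: mult_add_dim mult_assoc_dim)
    finally show ?thesis
      by (simp add: Z(3) Z'(3))
  qed
  define N' where "N' i = (if i < k then N i else e)" for i
  define C' where "C' i = (if i < k then C i * V\<^sup>\<dagger> else W\<^sup>\<dagger>)" for i
  define Y' where "Y' i = (if i < k then Y i else Z')" for i
  have carr: "(C i)\<^sup>\<dagger> * C i \<in> carrier_mat d d" "(C i)\<^sup>\<dagger> * Y i j * C i \<in> carrier_mat d d"
    if "i < k" for i j
    by (rule carrier_matI; simp add: dims[OF that])+
  have comb': "matrix_convex_combination n (Suc k) N' C' Y' X"
  proof (rule matrix_convex_combinationI)
    show "1 \<le> n"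
      using isometry_dim_le[OF V] c(1) by simp
    show "1 \<le> N' i" "Y' i \<in> SMn (N' i)" "C' i \<in> carrier_mat (N' i) n" if "i < Suc k" for i
      using that c(3)[of i] c(4)[of i] mult_carrier_mat[OF c(5)[of i] mat_adjoint_carrier[OF V(1)]] e Z'(2) W
      by (auto simp: N'_def Y'_def C'_def)
    have "mat_sum n n (Suc k) (\<lambda>i. (C' i)\<^sup>\<dagger> * C' i) =
        mat_sum n n k (\<lambda>i. (C' i)\<^sup>\<dagger> * C' i) + (C' k)\<^sup>\<dagger> * C' k"
      using vd by (intro mat_sum_Suc carrier_matI) (auto simp: C'_def)
    also have "mat_sum n n k (\<lambda>i. (C' i)\<^sup>\<dagger> * C' i) = mat_sum n n k (\<lambda>i. V * ((C i)\<^sup>\<dagger> * C i) * V\<^sup>\<dagger>)"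
      using dims vd by (intro mat_sum_cong) (simp add: C'_def adjoint_mult mult_assoc_dim)
    also have "\<dots> = V * mat_sum d d k (\<lambda>i. (C i)\<^sup>\<dagger> * C i) * V\<^sup>\<dagger>"
      by (rule mult_mat_sum_mult[OF V(1) mat_adjoint_carrier[OF V(1)] carr(1), symmetric])
    finally show "mat_sum n n (Suc k) (\<lambda>i. (C' i)\<^sup>\<dagger> * C' i) = 1\<^sub>m n"
      using vd by (simp add: c(6) C'_def VW)
    fix j
    have "mat_sum n n (Suc k) (\<lambda>i. (C' i)\<^sup>\<dagger> * Y' i j * C' i) =
        mat_sum n n k (\<lambda>i. (C' i)\<^sup>\<dagger> * Y' i j * C' i) + (C' k)\<^sup>\<dagger> * Y' k j * C' k"
      using vd by (intro mat_sum_Suc carrier_matI) (auto simp: C'_def)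
    also have "mat_sum n n k (\<lambda>i. (C' i)\<^sup>\<dagger> * Y' i j * C' i) =
        mat_sum n n k (\<lambda>i. V * ((C i)\<^sup>\<dagger> * Y i j * C i) * V\<^sup>\<dagger>)"
      using dims vd by (intro mat_sum_cong) (simp add: C'_def Y'_def adjoint_mult mult_assoc_dim)
    also have "\<dots> = V * mat_sum d d k (\<lambda>i. (C i)\<^sup>\<dagger> * Y i j * C i) * V\<^sup>\<dagger>"
      by (rule mult_mat_sum_mult[OF V(1) mat_adjoint_carrier[OF V(1)] carr(2), symmetric])
    also have "\<dots> = V * Z j * V\<^sup>\<dagger>"
      by (simp flip: c(7))
    finally show "X j = mat_sum n n (Suc k) (\<lambda>i. (C' i)\<^sup>\<dagger> * Y' i j * C' i)"
      by (simp add: X_split C'_def Y'_def)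
  qed
  have "Y' i \<in> K" if "i < Suc k" for i
    using Y[of i] Z'(1) by (auto simp: Y'_def)
  from arveson_extremeD(3)[OF X comb' this, of l j] l
  have "Y l j * (C l * V\<^sup>\<dagger>) = C l * V\<^sup>\<dagger> * X j"
    by (simp add: Y'_def C'_def)
  then have "Y l j * (C l * V\<^sup>\<dagger>) * V = C l * V\<^sup>\<dagger> * X j * V"
    by simp
  then have "Y l j * C l * (V\<^sup>\<dagger> * V) = C l * (V\<^sup>\<dagger> * V) * Z j"
    using dims[OF l] vd by (simp add: mult_assoc_dim Z(3))
  then show "Y l j * C l = C l * Z j"
    using dims[OF l] vd by (simp add: V(2))
qed

text \<open>
  The coefficients of a combination of \<open>X\<close> intertwine, so every \<open>(V i)\<^sup>\<dagger> * V i\<close> commutes with \<open>X\<close>. If it is scalar, \<open>V i\<close> is a multiple of an isometry and \<open>Y i\<close> splits off \<open>X\<close>, as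
  free extremality asks. Otherwise an eigenspace reduces \<open>X\<close>.
\<close>

lemma arveson_extreme_free_or_reducible:
  fixes K :: "('g::finite, 'a) mtuple set"
  assumes K: "matrix_convex K" and X: "arveson_extreme n K X" and nfe: "X \<notin> free_extreme_points K"
  shows "\<exists>d V. 1 \<le> d \<and> d < n \<and> V \<in> carrier_mat n d \<and> V\<^sup>\<dagger> * V = 1\<^sub>m d \<and>
    (\<forall>j. X j * V = V * (V\<^sup>\<dagger> * X j * V))"
proof -
  note XK = arveson_extremeD(1)[OF X] and Xs = arveson_extremeD(2)[OF X]
  have n: "1 \<le> n"
    using SM_size_ge_1[OF matrix_convexD(1)[OF K] XK Xs] .
  then obtain k N V Y where comb: "matrix_convex_combination n k N V Y X"
    and Y: "\<And>i. i < k \<Longrightarrow> Y i \<in> K" and V0: "\<And>i. i < k \<Longrightarrow> V i \<noteq> 0\<^sub>m (N i) n"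
    and viol: "\<not> (\<forall>i<k. (N i = n \<and> unitarily_equivalent n X (Y i)) \<or>
                (N i > n \<and> (\<exists>Z \<in> K. unitarily_equivalent (N i) (direct_sum X Z) (Y i))))"
    using nfe XK Xs unfolding free_extreme_points_def by blast
  from viol obtain i where i: "i < k" and viol: "\<not> ((N i = n \<and> unitarily_equivalent n X (Y i)) \<or>
      (N i > n \<and> (\<exists>Z \<in> K. unitarily_equivalent (N i) (direct_sum X Z) (Y i))))"
    by blast
  note c = matrix_convex_combinationD[OF comb]
  define v where "v = V i"
  define M where "M = Y i"
  define P where "P = v\<^sup>\<dagger> * v"
  have v: "v \<in> carrier_mat (N i) n" and M: "M \<in> SMn (N i)" and v0: "v \<noteq> 0\<^sub>m (N i) n"
    using c(4,5)[OF i] V0[OF i] by (auto simp: v_def M_def)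
  have inter: "M j * v = v * X j" for j
    using arveson_extremeD(3)[OF X comb Y i] by (simp add: v_def M_def)
  note d = carrier_matD[OF v] SMnD(3,4)[OF M] SMnD(3,4)[OF Xs]
  have P: "P \<in> carrier_mat n n" "P\<^sup>\<dagger> = P"
    using v d by (auto simp: P_def adjoint_mult)
  have comm: "X j * P = P * X j" for j
  proof -
    have "v\<^sup>\<dagger> * M j = (M j * v)\<^sup>\<dagger>"
      using d SMnD(2)[OF M] by (simp add: adjoint_mult)
    also have "\<dots> = X j * v\<^sup>\<dagger>"
      using d SMnD(2)[OF Xs] by (simp add: inter adjoint_mult)
    finally have "v\<^sup>\<dagger> * M j * v = X j * v\<^sup>\<dagger> * v"
      by simp
    then show ?thesis
      using d by (simp add: mult_assoc_dim inter P_def)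
  qed
  have non_scalar: "P \<noteq> a \<cdot>\<^sub>m 1\<^sub>m n" for a
  proof
    assume "P = a \<cdot>\<^sub>m 1\<^sub>m n"
    then obtain s where "s \<noteq> 0" and s: "(s \<cdot>\<^sub>m v)\<^sup>\<dagger> * (s \<cdot>\<^sub>m v) = 1\<^sub>m n"
      using gram_scalar_normalize[OF v _ v0] unfolding P_def by blast
    have "M j * (s \<cdot>\<^sub>m v) = (s \<cdot>\<^sub>m v) * X j" for j
      using d by (simp add: mult_smult_dim smult_mult_dim inter)
    from intertwining_isometry_splits[OF K Xs _ M _ s this] Y[OF i] v viol
    show False
      by (auto simp: M_def)
  qed
  obtain w a where w: "w \<in> carrier_mat n 1" "w \<noteq> 0\<^sub>m n 1" and Pw: "P * w = a \<cdot>\<^sub>m w"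
    using eigenvector_ex[OF P] n by auto
  \<comment> \<open>the eigenspace of \<open>P\<close> as a kernel; it is proper because \<open>P\<close> is not scalar\<close>
  define Q where "Q = P - a \<cdot>\<^sub>m 1\<^sub>m n"
  have Q: "Q \<in> carrier_mat n n"
    using P by (auto simp: Q_def)
  have Qw: "Q * w = 0\<^sub>m n 1"
    using w carrier_matD[OF w(1)] carrier_matD[OF P(1)]
    by (simp add: Q_def minus_mult_dim smult_mult_dim Pw)
  have Qcomm: "X j * Q = Q * X j" for j
    using d carrier_matD[OF P(1)]
    by (simp add: Q_def minus_mult_dim mult_minus_dim smult_mult_dim mult_smult_dim comm)
  obtain e U where U: "U \<in> carrier_mat n e" "U\<^sup>\<dagger> * U = 1\<^sub>m e" and QU: "Q * U = 0\<^sub>m n e"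
    and span: "\<And>p B. B \<in> carrier_mat n p \<Longrightarrow> Q * B = 0\<^sub>m n p \<Longrightarrow> U * (U\<^sup>\<dagger> * B) = B"
    using kernel_isometry[OF Q] by metis
  note ud = carrier_matD[OF U(1)] carrier_matD[OF Q] carrier_matD[OF w(1)]
  have "e \<noteq> 0"
  proof
    assume "e = 0"
    then have "U * (U\<^sup>\<dagger> * w) = 0\<^sub>m n 1"
      using ud by (auto simp: mult_index simp del: index_mult_mat(1) intro!: eq_matI)
    then show False
      using span[OF w(1) Qw] w(2) by simp
  qed
  moreover have "e \<noteq> n"
  proof
    assume "e = n"
    then have UU: "U * U\<^sup>\<dagger> = 1\<^sub>m n"
      using square_isometry_right_inverse[of U n] U by simp
    have "Q * (U * U\<^sup>\<dagger>) = Q * U * U\<^sup>\<dagger>"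
      using ud by (simp add: mult_assoc_dim)
    then have "Q = 0\<^sub>m n n"
      using ud by (simp add: UU QU)
    then have "P = a \<cdot>\<^sub>m 1\<^sub>m n"
      unfolding Q_def by (rule minus_eq_zero_mat) (use P in auto)
    then show False
      using non_scalar by blast
  qed
  moreover have "e \<le> n"
    using isometry_dim_le[OF U] .
  moreover have "X j * U = U * (U\<^sup>\<dagger> * X j * U)" for j
  proof -
    have "Q * (X j * U) = X j * (Q * U)"
      using ud d Qcomm[of j] by (simp flip: mult_assoc_dim)
    then have "Q * (X j * U) = 0\<^sub>m n e"
      using d by (simp add: QU)
    then have "U * (U\<^sup>\<dagger> * (X j * U)) = X j * U"
      by (rule span[OF mult_carrier_mat[OF SMnD(1)[OF Xs] U(1)]])
    then show ?thesis
      using ud d by (simp add: mult_assoc_dim)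
  qed
  ultimately show ?thesis
    using U by (intro exI[of _ e] exI[of _ U]) auto
qed

text \<open>
  Splitting off reducing subspaces as long as there are any, the sizes of the summands add up to
  that of \<open>X\<close>, and every summand is again Arveson extreme.
\<close>

lemma arveson_extreme_combination:
  fixes K :: "('g::finite, 'a) mtuple set"
  assumes K: "matrix_convex K" and X: "arveson_extreme n K X"
  shows "combination_of_total_size_le (free_extreme_points K) n X"
  using X
proof (induction n arbitrary: X rule: less_induct)
  case (less n X)
  note X = less.prems
  note XK = arveson_extremeD(1)[OF X] and Xs = arveson_extremeD(2)[OF X]
  have n: "1 \<le> n"
    using SM_size_ge_1[OF matrix_convexD(1)[OF K] XK Xs] .
  show ?case
  proof (cases "X \<in> free_extreme_points K")
    case True
    have "matrix_convex_combination n 1 (\<lambda>_. n) (\<lambda>_. 1\<^sub>m n) (\<lambda>_. X) X"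
      using SMnD(3,4)[OF Xs] by (intro compression_combination[OF Xs _ _ n n]) auto
    then show ?thesis
      unfolding combination_of_total_size_le_def using True
      by (intro exI[of _ n] exI[of _ 1] exI[of _ "\<lambda>_. n"] exI[of _ "\<lambda>_. 1\<^sub>m n"] exI[of _ "\<lambda>_. X"]) auto
  next
    case False
    obtain d V where d: "1 \<le> d" "d < n" and V: "V \<in> carrier_mat n d" "V\<^sup>\<dagger> * V = 1\<^sub>m d"
      and red: "\<And>j. X j * V = V * (V\<^sup>\<dagger> * X j * V)"
      using arveson_extreme_free_or_reducible[OF K X False] by blast
    let ?e = "n - d"
    have e: "1 \<le> ?e" "?e < n" using d by auto
    obtain W where W: "W \<in> carrier_mat n ?e" "W\<^sup>\<dagger> * W = 1\<^sub>m ?e" and VW: "V\<^sup>\<dagger> * W = 0\<^sub>m d ?e"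
      and sum: "V * V\<^sup>\<dagger> + W * W\<^sup>\<dagger> = 1\<^sub>m n"
      using isometry_complement[OF V] by blast
    note dm = carrier_matD[OF V(1)] carrier_matD[OF W(1)] SMnD(3,4)[OF Xs]
    define Z where "Z j = V\<^sup>\<dagger> * X j * V" for j
    define Z' where "Z' j = W\<^sup>\<dagger> * X j * W" for j
    have Z: "Z \<in> K" "Z \<in> SMn d" "\<And>j. X j * V = V * Z j"
      unfolding Z_def using matrix_convex_compress[OF K XK Xs V d(1)] SMn_compress[OF Xs V(1)] red by auto
    have XW: "X j * W = W * Z' j" for j
    proof -
      have "V\<^sup>\<dagger> * (X j * W) = (W\<^sup>\<dagger> * (X j * V))\<^sup>\<dagger>"
        using dm SMnD(2)[OF Xs] by (simp add: adjoint_mult mult_assoc_dim)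
      also have "W\<^sup>\<dagger> * (X j * V) = (V\<^sup>\<dagger> * W)\<^sup>\<dagger> * Z j"
        using dm SMnD(3,4)[OF Z(2)] by (simp add: Z(3) adjoint_mult mult_assoc_dim)
      also have "\<dots> = 0\<^sub>m ?e d"
        using SMnD(3,4)[OF Z(2)] by (simp add: VW)
      finally have 0: "V\<^sup>\<dagger> * (X j * W) = 0\<^sub>m d ?e"
        by simp
      have "X j * W = (V * V\<^sup>\<dagger> + W * W\<^sup>\<dagger>) * (X j * W)"
        using dm by (simp add: sum)
      also have "\<dots> = V * (V\<^sup>\<dagger> * (X j * W)) + W * Z' j"
        using dm by (simp add: add_mult_dim mult_assoc_dim Z'_def)
      also have "\<dots> = W * Z' j"
        using dm unfolding 0 by (simp add: Z'_def)
      finally show ?thesis .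
    qed
    have Z': "Z' \<in> K" "Z' \<in> SMn ?e"
      unfolding Z'_def using matrix_convex_compress[OF K XK Xs W e(1)] SMn_compress[OF Xs W(1)] by auto
    have "arveson_extreme d K Z"
      by (rule arveson_extreme_summand[OF X V W(1) sum e(1) Z Z' XW])
    then have cZ: "weighted_combination (free_extreme_points K) d d (1\<^sub>m d) Z"
      using less.IH[OF d(2)] combination_weighted Z(2) by blast
    have sum': "W * W\<^sup>\<dagger> + V * V\<^sup>\<dagger> = 1\<^sub>m n"
      using sum comm_add_mat[of "V * V\<^sup>\<dagger>" n n "W * W\<^sup>\<dagger>"] V W by simp
    have "arveson_extreme ?e K Z'"
      by (rule arveson_extreme_summand[OF X W V(1) sum' d(1) Z' XW Z])
    then have cZ': "weighted_combination (free_extreme_points K) ?e ?e (1\<^sub>m ?e) Z'"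
      using less.IH[OF e(2)] combination_weighted Z'(2) by blast
    have "weighted_combination (free_extreme_points K) (d + ?e) n
        ((V\<^sup>\<dagger>)\<^sup>\<dagger> * 1\<^sub>m d * V\<^sup>\<dagger> + (W\<^sup>\<dagger>)\<^sup>\<dagger> * 1\<^sub>m ?e * W\<^sup>\<dagger>)
        (\<lambda>j. (V\<^sup>\<dagger>)\<^sup>\<dagger> * Z j * V\<^sup>\<dagger> + (W\<^sup>\<dagger>)\<^sup>\<dagger> * Z' j * W\<^sup>\<dagger>)"
      by (rule weighted_combination_add[
          OF weighted_combination_compress[OF cZ mat_adjoint_carrier[OF V(1)]]
            weighted_combination_compress[OF cZ' mat_adjoint_carrier[OF W(1)]]])
    moreover have "(V\<^sup>\<dagger>)\<^sup>\<dagger> * Z j * V\<^sup>\<dagger> + (W\<^sup>\<dagger>)\<^sup>\<dagger> * Z' j * W\<^sup>\<dagger> = X j" for j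
    proof -
      have "X j = X j * (V * V\<^sup>\<dagger> + W * W\<^sup>\<dagger>)"
        using dm by (simp add: sum)
      also have "\<dots> = X j * V * V\<^sup>\<dagger> + X j * W * W\<^sup>\<dagger>"
        using dm by (simp add: mult_add_dim mult_assoc_dim)
      finally show ?thesis
        by (simp add: Z(3) XW)
    qed
    moreover have "(V\<^sup>\<dagger>)\<^sup>\<dagger> * 1\<^sub>m d * V\<^sup>\<dagger> + (W\<^sup>\<dagger>)\<^sup>\<dagger> * 1\<^sub>m ?e * W\<^sup>\<dagger> = 1\<^sub>m n"
      using dm by (simp add: sum)
    ultimately have "weighted_combination (free_extreme_points K) n n (1\<^sub>m n) X"
      using d by simp
    then show ?thesis
      using n combination_iff_weighted by blast
  qed
qed

end

section \<open>Real points\<close>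

abbreviation cmat :: "real mat \<Rightarrow> complex mat" where
  "cmat \<equiv> map_mat complex_of_real"

lemma cmat_mult: "dim_col A = dim_row B \<Longrightarrow> cmat (A * B) = cmat A * cmat B"
  by (rule eq_matI) (auto simp: mult_index simp del: index_mult_mat(1))

lemma cmat_adjoint: "cmat (A\<^sup>\<dagger>) = (cmat A)\<^sup>\<dagger>"
  by (rule eq_matI) auto

lemma cmat_mat_sum:
  assumes "\<And>i. i < k \<Longrightarrow> A i \<in> carrier_mat r c"
  shows "cmat (mat_sum r c k A) = mat_sum r c k (\<lambda>i. cmat (A i))"
proof (rule eq_matI)
  fix a b assume ab: "a < dim_row (mat_sum r c k (\<lambda>i. cmat (A i)))" "b < dim_col (mat_sum r c k (\<lambda>i. cmat (A i)))"
  have "cmat (A i) $$ (a, b) = complex_of_real (A i $$ (a, b))" if "i < k" for i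
    using ab carrier_matD[OF assms[OF that]] by simp
  then show "cmat (mat_sum r c k A) $$ (a, b) = mat_sum r c k (\<lambda>i. cmat (A i)) $$ (a, b)"
    using ab by simp
qed auto

lemma cmat_one: "cmat (1\<^sub>m n) = 1\<^sub>m n"
  by (rule eq_matI) auto

lemma map_Re_cmat [simp]: "map_mat Re (cmat A) = A"
  by (rule eq_matI) auto

lemma cmat_inj: "cmat A = cmat B \<Longrightarrow> A = B"
  by (metis map_Re_cmat)

lemma cmat_minus: "dim_row A = dim_row B \<Longrightarrow> dim_col A = dim_col B \<Longrightarrow> cmat (A - B) = cmat A - cmat B"
  by (rule eq_matI) auto

lemma cmat_SMn_iff: "(\<lambda>j. cmat (X j)) \<in> SMn n \<longleftrightarrow> X \<in> SMn n"
  by (auto simp: SMn_def cmat_adjoint[symmetric] dest: cmat_inj)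

lemma cmat_combination:
  assumes "matrix_convex_combination n k N V Y X"
  shows "matrix_convex_combination n k N (\<lambda>i. cmat (V i)) (\<lambda>i j. cmat (Y i j)) (\<lambda>j. cmat (X j))"
proof -
  note c = matrix_convex_combinationD[OF assms]
  have dims: "dim_row (V i) = N i" "dim_col (V i) = n" "dim_row (Y i j) = N i" "dim_col (Y i j) = N i"
    if "i < k" for i j
    using c(5)[OF that] SMnD(3,4)[OF c(4)[OF that]] by auto
  show ?thesis
  proof (rule matrix_convex_combinationI[OF c(1,3)])
    show "(\<lambda>j. cmat (Y i j)) \<in> SMn (N i)" "cmat (V i) \<in> carrier_mat (N i) n" if "i < k" for i
      using c(4,5)[OF that] by (auto simp: cmat_SMn_iff)
    have "mat_sum n n k (\<lambda>i. (cmat (V i))\<^sup>\<dagger> * cmat (V i)) = mat_sum n n k (\<lambda>i. cmat ((V i)\<^sup>\<dagger> * V i))"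
      by (intro mat_sum_cong) (simp add: cmat_mult cmat_adjoint)
    also have "\<dots> = cmat (mat_sum n n k (\<lambda>i. (V i)\<^sup>\<dagger> * V i))"
      using dims by (intro cmat_mat_sum[symmetric]) (auto intro!: carrier_matI)
    finally show "mat_sum n n k (\<lambda>i. (cmat (V i))\<^sup>\<dagger> * cmat (V i)) = 1\<^sub>m n"
      by (simp add: c(6) cmat_one)
    fix j
    have "mat_sum n n k (\<lambda>i. (cmat (V i))\<^sup>\<dagger> * cmat (Y i j) * cmat (V i)) =
        mat_sum n n k (\<lambda>i. cmat ((V i)\<^sup>\<dagger> * Y i j * V i))"
      using dims by (intro mat_sum_cong) (simp add: cmat_mult cmat_adjoint)
    also have "\<dots> = cmat (mat_sum n n k (\<lambda>i. (V i)\<^sup>\<dagger> * Y i j * V i))"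
      using dims by (intro cmat_mat_sum[symmetric]) (auto intro!: carrier_matI)
    finally show "cmat (X j) = mat_sum n n k (\<lambda>i. (cmat (V i))\<^sup>\<dagger> * cmat (Y i j) * cmat (V i))"
      by (simp flip: c(7))
  qed
qed

lemma real_points_iff:
  assumes "K \<subseteq> SM"
  shows "X \<in> real_points K \<longleftrightarrow> (\<lambda>j. cmat (X j)) \<in> K"
proof -
  have "X \<in> SM" if "(\<lambda>j. cmat (X j)) \<in> K"
    using SM_memD[OF assms that] by (auto simp: cmat_SMn_iff SM_def)
  then show ?thesis
    by (auto simp: real_points_def)
qed

lemma matrix_convex_real_points:
  assumes K: "matrix_convex K"
  shows "matrix_convex (real_points K)"
  unfolding matrix_convex_def
proof (intro conjI allI impI)
  show "real_points K \<subseteq> SM" by (auto simp: real_points_def)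
  fix n k N V Y X
  assume "matrix_convex_combination n k N V Y X \<and> (\<forall>i<k. Y i \<in> real_points K)"
  then show "X \<in> real_points K"
    using matrix_convexD(2)[OF K cmat_combination] real_points_iff[OF matrix_convexD(1)[OF K]] by blast
qed

lemma combination_compress:
  assumes comb: "matrix_convex_combination n k N V Y X"
    and P: "P \<in> carrier_mat n p" "P\<^sup>\<dagger> * P = 1\<^sub>m p" and p: "1 \<le> p"
  shows "matrix_convex_combination p k N (\<lambda>i. V i * P) Y (\<lambda>j. P\<^sup>\<dagger> * X j * P)"
proof -
  note c = matrix_convex_combinationD[OF comb] and Pd = carrier_matD[OF P(1)]
  have dims: "dim_row (V i) = N i" "dim_col (V i) = n" "dim_row (Y i j) = N i" "dim_col (Y i j) = N i"
    if "i < k" for i j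
    using c(5)[OF that] SMnD(3,4)[OF c(4)[OF that]] by auto
  have carr: "(V i)\<^sup>\<dagger> * V i \<in> carrier_mat n n" "(V i)\<^sup>\<dagger> * Y i j * V i \<in> carrier_mat n n"
    if "i < k" for i j
    by (rule carrier_matI; simp add: dims[OF that])+
  show ?thesis
  proof (rule matrix_convex_combinationI[OF p c(3,4)])
    show "V i * P \<in> carrier_mat (N i) p" if "i < k" for i
      using c(5)[OF that] P(1) by (rule mult_carrier_mat)
    have "mat_sum p p k (\<lambda>i. (V i * P)\<^sup>\<dagger> * (V i * P)) = mat_sum p p k (\<lambda>i. P\<^sup>\<dagger> * ((V i)\<^sup>\<dagger> * V i) * P)"
      using dims Pd by (intro mat_sum_cong) (simp add: adjoint_mult mult_assoc_dim)
    also have "\<dots> = P\<^sup>\<dagger> * mat_sum n n k (\<lambda>i. (V i)\<^sup>\<dagger> * V i) * P"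
      by (rule mult_mat_sum_mult[OF mat_adjoint_carrier[OF P(1)] P(1) carr(1), symmetric])
    finally show "mat_sum p p k (\<lambda>i. (V i * P)\<^sup>\<dagger> * (V i * P)) = 1\<^sub>m p"
      using Pd by (simp add: c(6) P(2))
    fix j
    have "mat_sum p p k (\<lambda>i. (V i * P)\<^sup>\<dagger> * Y i j * (V i * P)) =
        mat_sum p p k (\<lambda>i. P\<^sup>\<dagger> * ((V i)\<^sup>\<dagger> * Y i j * V i) * P)"
      using dims Pd by (intro mat_sum_cong) (simp add: adjoint_mult mult_assoc_dim)
    also have "\<dots> = P\<^sup>\<dagger> * mat_sum n n k (\<lambda>i. (V i)\<^sup>\<dagger> * Y i j * V i) * P"
      by (rule mult_mat_sum_mult[OF mat_adjoint_carrier[OF P(1)] P(1) carr(2), symmetric])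
    finally show "P\<^sup>\<dagger> * X j * P = mat_sum p p k (\<lambda>i. (V i * P)\<^sup>\<dagger> * Y i j * (V i * P))"
      by (simp flip: c(7))
  qed
qed

section \<open>Complex combinations of real tuples\<close>

lemma sum_lessThan_add:
  fixes f :: "nat \<Rightarrow> 'a::comm_monoid_add"
  shows "(\<Sum>l<m + n. f l) = (\<Sum>l<m. f l) + (\<Sum>l<n. f (m + l))"
  by (induction n) (simp_all add: add.assoc)

definition vcat :: "'a mat \<Rightarrow> 'a mat \<Rightarrow> 'a mat" where
  "vcat P Q = mat (dim_row P + dim_row Q) (dim_col P)
     (\<lambda>(a, b). if a < dim_row P then P $$ (a, b) else Q $$ (a - dim_row P, b))"

lemma vcat_dim [simp]: "dim_row (vcat P Q) = dim_row P + dim_row Q" "dim_col (vcat P Q) = dim_col P"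
  by (auto simp: vcat_def)

lemma vcat_index:
  "a < dim_row P + dim_row Q \<Longrightarrow> b < dim_col P \<Longrightarrow>
    vcat P Q $$ (a, b) = (if a < dim_row P then P $$ (a, b) else Q $$ (a - dim_row P, b))"
  by (simp add: vcat_def)

lemma vcat_eqD:
  assumes "vcat P Q = vcat P' Q'" "dim_row P = dim_row P'" "dim_col Q = dim_col P" "dim_col Q' = dim_col P'"
  shows "P = P'" "Q = Q'"
proof -
  have d: "dim_col P = dim_col P'" "dim_row Q = dim_row Q'"
    using arg_cong[OF assms(1), of dim_col] arg_cong[OF assms(1), of dim_row] assms(2) by auto
  show "P = P'"
  proof (rule eq_matI)
    fix a b assume "a < dim_row P'" "b < dim_col P'"
    then show "P $$ (a, b) = P' $$ (a, b)"
      using arg_cong[OF assms(1), of "\<lambda>A. A $$ (a, b)"] assms(2-4) d by (simp add: vcat_index)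
  qed (use assms d in auto)
  show "Q = Q'"
  proof (rule eq_matI)
    fix a b assume "a < dim_row Q'" "b < dim_col Q'"
    then show "Q $$ (a, b) = Q' $$ (a, b)"
      using arg_cong[OF assms(1), of "\<lambda>A. A $$ (dim_row P + a, b)"] assms(2-4) d by (simp add: vcat_index)
  qed (use assms d in auto)
qed

lemma adjoint_vcat_mult_vcat:
  fixes P Q P' Q' :: "'a::conjugatable_field mat"
  assumes "dim_row P = dim_row P'" "dim_row Q = dim_row Q'" "dim_col Q = dim_col P" "dim_col Q' = dim_col P'"
  shows "(vcat P Q)\<^sup>\<dagger> * vcat P' Q' = P\<^sup>\<dagger> * P' + Q\<^sup>\<dagger> * Q'"
  using assms
  by (intro eq_matI) (auto simp: mult_index vcat_index sum_lessThan_add simp del: index_mult_mat(1))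

lemma four_block_mult_vcat:
  fixes A B C D P Q :: "'a::semiring_0 mat"
  assumes "A \<in> carrier_mat r c" "B \<in> carrier_mat r c'" "C \<in> carrier_mat r' c" "D \<in> carrier_mat r' c'"
    "dim_row P = c" "dim_row Q = c'" "dim_col Q = dim_col P"
  shows "four_block_mat A B C D * vcat P Q = vcat (A * P + B * Q) (C * P + D * Q)" (is "?L = ?R")
proof (rule eq_matI)
  note d = carrier_matD[OF assms(1)] carrier_matD[OF assms(2)] carrier_matD[OF assms(3)] carrier_matD[OF assms(4)]
  fix a b assume "a < dim_row ?R" "b < dim_col ?R"
  then have ab: "a < r + r'" "b < dim_col P" using d assms(7) by auto
  show "?L $$ (a, b) = ?R $$ (a, b)"
    using ab assms(5-7) d
    by (auto simp: mult_index vcat_index sum_lessThan_add simp del: index_mult_mat(1))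
qed (use assms in auto)

lemma hcat_mult_adjoint_hcat:
  fixes A B :: "'a::conjugatable_field mat"
  assumes "dim_row B = dim_row A"
  shows "hcat A B * (hcat A B)\<^sup>\<dagger> = A * A\<^sup>\<dagger> + B * B\<^sup>\<dagger>"
  using assms
  by (intro eq_matI) (auto simp: mult_index hcat_index sum_lessThan_add simp del: index_mult_mat(1))

lemma map_Re_mult:
  "dim_col A = dim_row B \<Longrightarrow> map_mat Re (A * B) = map_mat Re A * map_mat Re B - map_mat Im A * map_mat Im B"
  by (rule eq_matI) (auto simp: mult_index sum_subtractf simp del: index_mult_mat(1))

lemma map_Im_mult:
  "dim_col A = dim_row B \<Longrightarrow> map_mat Im (A * B) = map_mat Re A * map_mat Im B + map_mat Im A * map_mat Re B"
  by (rule eq_matI) (auto simp: mult_index sum.distrib simp del: index_mult_mat(1))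

lemma map_Re_mat_sum:
  assumes "\<And>i. i < k \<Longrightarrow> A i \<in> carrier_mat r c"
  shows "map_mat Re (mat_sum r c k A) = mat_sum r c k (\<lambda>i. map_mat Re (A i))"
proof (rule eq_matI)
  fix a b assume ab: "a < dim_row (mat_sum r c k (\<lambda>i. map_mat Re (A i)))" "b < dim_col (mat_sum r c k (\<lambda>i. map_mat Re (A i)))"
  have "map_mat Re (A i) $$ (a, b) = Re (A i $$ (a, b))" if "i < k" for i
    using ab carrier_matD[OF assms[OF that]] by simp
  then show "map_mat Re (mat_sum r c k A) $$ (a, b) = mat_sum r c k (\<lambda>i. map_mat Re (A i)) $$ (a, b)"
    using ab by simp
qed auto

text \<open>
  The sign makes \<open>real_column\<close> turn multiplication by a self-adjoint complex tuple into
  multiplication by its realification, and complex inner products into their real parts.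
\<close>

definition real_column :: "complex mat \<Rightarrow> real mat" where
  "real_column V = vcat (map_mat Re V) (- map_mat Im V)"

lemma real_column_dim [simp]:
  "dim_row (real_column V) = dim_row V + dim_row V" "dim_col (real_column V) = dim_col V"
  by (auto simp: real_column_def)

lemma real_column_inj:
  assumes "real_column V = real_column W" "dim_row V = dim_row W"
  shows "V = W"
proof -
  have dc: "dim_col V = dim_col W"
    using arg_cong[OF assms(1), of dim_col] by simp
  have re: "map_mat Re V = map_mat Re W" and im: "- map_mat Im V = - map_mat Im W"
    by (rule vcat_eqD[OF assms(1)[unfolded real_column_def]]; simp add: assms(2))+
  show ?thesis
  proof (rule eq_matI)
    fix a b assume "a < dim_row W" "b < dim_col W"
    then show "V $$ (a, b) = W $$ (a, b)"
      using arg_cong[OF re, of "\<lambda>A. A $$ (a, b)"] arg_cong[OF im, of "\<lambda>A. A $$ (a, b)"] assms(2) dc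
      by (simp add: complex_eq_iff)
  qed (use assms(2) dc in auto)
qed

lemma adjoint_real_column_mult:
  assumes "dim_row V = dim_row W"
  shows "(real_column V)\<^sup>\<dagger> * real_column W = map_mat Re (V\<^sup>\<dagger> * W)"
proof -
  have "map_mat Re (V\<^sup>\<dagger>) = (map_mat Re V)\<^sup>\<dagger>" "map_mat Im (V\<^sup>\<dagger>) = - (map_mat Im V)\<^sup>\<dagger>"
    by (rule eq_matI; simp)+
  moreover have "(- map_mat Im V)\<^sup>\<dagger> * (- map_mat Im W) = (map_mat Im V)\<^sup>\<dagger> * map_mat Im W"
    "- (map_mat Im V)\<^sup>\<dagger> * map_mat Im W = - ((map_mat Im V)\<^sup>\<dagger> * map_mat Im W)"
    using assms
    by (auto simp: mult_index sum_negf simp del: index_mult_mat(1) intro!: eq_matI)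
  ultimately show ?thesis
    using assms unfolding real_column_def
    by (subst adjoint_vcat_mult_vcat) (auto simp: map_Re_mult intro!: eq_matI)
qed

lemma real_column_mult_real:
  assumes "dim_col V = dim_row B"
  shows "real_column V * B = real_column (V * cmat B)"
  using assms
  by (intro eq_matI) (auto simp: real_column_def mult_index vcat_index sum_negf simp del: index_mult_mat(1))

lemma self_adjoint_Re_Im:
  assumes "Z \<in> SMn n" "a < n" "b < n"
  shows "Re (Z j $$ (a, b)) = Re (Z j $$ (b, a))" "Im (Z j $$ (a, b)) = - Im (Z j $$ (b, a))"
proof -
  have "Z j $$ (a, b) = (Z j)\<^sup>\<dagger> $$ (a, b)"
    using SMnD(2)[OF assms(1)] by simp
  then have "Z j $$ (a, b) = cnj (Z j $$ (b, a))"
    using assms SMnD(3,4)[OF assms(1)] by simp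
  then show "Re (Z j $$ (a, b)) = Re (Z j $$ (b, a))" "Im (Z j $$ (a, b)) = - Im (Z j $$ (b, a))"
    by (simp_all add: complex_eq_iff)
qed

lemma realification_dim:
  assumes "Z \<in> SMn n"
  shows "realification Z j \<in> carrier_mat (n + n) (n + n)"
    "dim_row (realification Z j) = n + n" "dim_col (realification Z j) = n + n"
  using SMnD(3,4)[OF assms] by (auto simp: realification_def intro!: carrier_matI)

lemma realification_SMn:
  assumes "Z \<in> SMn n"
  shows "realification Z \<in> SMn (n + n)"
proof -
  have "(realification Z j)\<^sup>\<dagger> = realification Z j" for j
  proof (rule eq_matI)
    fix a b assume "a < dim_row (realification Z j)" "b < dim_col (realification Z j)"
    then have ab: "a < n + n" "b < n + n"
      using realification_dim[OF assms] by auto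
    then have "(realification Z j)\<^sup>\<dagger> $$ (a, b) = realification Z j $$ (b, a)"
      using realification_dim[OF assms] by simp
    also have "\<dots> = realification Z j $$ (a, b)"
      using ab SMnD(3,4)[OF assms, of j] self_adjoint_Re_Im(1)[OF assms, of a b j]
        self_adjoint_Re_Im(1)[OF assms, of "a - n" "b - n" j]
      by (simp add: realification_def)
    finally show "(realification Z j)\<^sup>\<dagger> $$ (a, b) = realification Z j $$ (a, b)" .
  qed (simp_all add: realification_dim[OF assms])
  then show ?thesis
    using realification_dim(1)[OF assms] by (simp add: SMn_def)
qed

lemma realification_mult_real_column:
  assumes Z: "Z \<in> SMn n" and V: "dim_row V = n"
  shows "realification Z j * real_column V = real_column (Z j * V)"
proof -
  note d = SMnD(3,4)[OF Z, of j]
  have T: "transpose_mat (map_mat Im (Z j)) = - map_mat Im (Z j)"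
  proof (rule eq_matI)
    fix a b assume "a < dim_row (- map_mat Im (Z j))" "b < dim_col (- map_mat Im (Z j))"
    then have "a < n" "b < n"
      using d by auto
    then show "transpose_mat (map_mat Im (Z j)) $$ (a, b) = (- map_mat Im (Z j)) $$ (a, b)"
      using d self_adjoint_Re_Im(2)[OF Z, of b a j] by simp
  qed (use d in auto)
  have "realification Z j * real_column V =
      vcat (map_mat Re (Z j) * map_mat Re V + map_mat Im (Z j) * (- map_mat Im V))
        (transpose_mat (map_mat Im (Z j)) * map_mat Re V + map_mat Re (Z j) * (- map_mat Im V))"
    unfolding realification_def real_column_def
    using d V by (intro four_block_mult_vcat[where r = n and c = n and c' = n and r' = n])
      (auto intro!: carrier_matI)
  also have "\<dots> = real_column (Z j * V)"
    unfolding real_column_def T using d V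
    by (intro arg_cong2[where f = vcat] eq_matI)
      (auto simp: map_Re_mult map_Im_mult mult_index sum_negf simp del: index_mult_mat(1))
  finally show ?thesis .
qed

text \<open>
  The real part of \<open>(V i)\<^sup>\<dagger> * Z i * V i\<close> is the compression of the realification of \<open>Z i\<close> by the real
  column of \<open>V i\<close>, and a real tuple is its own real part.
\<close>

lemma realification_combination:
  assumes comb: "matrix_convex_combination n k N V Z (\<lambda>j. cmat (X j))"
  shows "matrix_convex_combination n k (\<lambda>i. N i + N i) (\<lambda>i. real_column (V i))
    (\<lambda>i. realification (Z i)) X"
proof -
  note c = matrix_convex_combinationD[OF comb]
  have dims: "dim_row (V i) = N i" "dim_col (V i) = n" "dim_row (Z i j) = N i" "dim_col (Z i j) = N i"
    if "i < k" for i j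
    using c(5)[OF that] SMnD(3,4)[OF c(4)[OF that]] by auto
  show ?thesis
  proof (rule matrix_convex_combinationI[OF c(1)])
    show "1 \<le> N i + N i" "realification (Z i) \<in> SMn (N i + N i)"
      "real_column (V i) \<in> carrier_mat (N i + N i) n" if "i < k" for i
      using c(3)[OF that] realification_SMn[OF c(4)[OF that]] dims[OF that] by (auto intro!: carrier_matI)
    have "mat_sum n n k (\<lambda>i. (real_column (V i))\<^sup>\<dagger> * real_column (V i)) =
        mat_sum n n k (\<lambda>i. map_mat Re ((V i)\<^sup>\<dagger> * V i))"
      by (intro mat_sum_cong adjoint_real_column_mult) simp
    also have "\<dots> = map_mat Re (mat_sum n n k (\<lambda>i. (V i)\<^sup>\<dagger> * V i))"
      using dims by (intro map_Re_mat_sum[symmetric]) (auto intro!: carrier_matI)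
    finally show "mat_sum n n k (\<lambda>i. (real_column (V i))\<^sup>\<dagger> * real_column (V i)) = 1\<^sub>m n"
      by (auto simp: c(6) intro!: eq_matI)
    fix j
    have "mat_sum n n k (\<lambda>i. (real_column (V i))\<^sup>\<dagger> * realification (Z i) j * real_column (V i)) =
        mat_sum n n k (\<lambda>i. map_mat Re ((V i)\<^sup>\<dagger> * Z i j * V i))"
    proof (intro mat_sum_cong)
      fix i assume i: "i < k"
      have "(real_column (V i))\<^sup>\<dagger> * realification (Z i) j * real_column (V i) =
          (real_column (V i))\<^sup>\<dagger> * real_column (Z i j * V i)"
        using dims[OF i] realification_dim[OF c(4)[OF i]] realification_mult_real_column[OF c(4)[OF i]]
        by (simp add: mult_assoc_dim)
      also have "\<dots> = map_mat Re ((V i)\<^sup>\<dagger> * Z i j * V i)"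
        using dims[OF i] by (simp add: adjoint_real_column_mult mult_assoc_dim)
      finally show "(real_column (V i))\<^sup>\<dagger> * realification (Z i) j * real_column (V i) =
          map_mat Re ((V i)\<^sup>\<dagger> * Z i j * V i)" .
    qed
    also have "\<dots> = map_mat Re (mat_sum n n k (\<lambda>i. (V i)\<^sup>\<dagger> * Z i j * V i))"
      using dims by (intro map_Re_mat_sum[symmetric]) (auto intro!: carrier_matI)
    also have "\<dots> = X j"
      by (simp flip: c(7))
    finally show "X j = mat_sum n n k (\<lambda>i. (real_column (V i))\<^sup>\<dagger> * realification (Z i) j * real_column (V i))"
      by simp
  qed
qed

text \<open>
  A complex combination of a real tuple yields a real one of realifications, and the intertwining
  relation of the latter is that of the former written in real columns.
\<close>

lemma arveson_extreme_complexification: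
  fixes K :: "('g::finite, complex) mtuple set"
  assumes K: "matrix_convex K" and RK: "\<And>X. X \<in> K \<Longrightarrow> realification X \<in> real_points K"
    and X: "arveson_extreme n (real_points K) X"
  shows "arveson_extreme n K (\<lambda>j. cmat (X j))"
proof (rule arveson_extremeI)
  note Xs = arveson_extremeD(1,2)[OF X]
  show "(\<lambda>j. cmat (X j)) \<in> K"
    using Xs real_points_iff[OF matrix_convexD(1)[OF K]] by blast
  show "(\<lambda>j. cmat (X j)) \<in> SMn n"
    using Xs by (simp add: cmat_SMn_iff)
  fix k N V Y l j
  assume comb: "matrix_convex_combination n k N V Y (\<lambda>j. cmat (X j))"
    and Y: "\<And>i. i < k \<Longrightarrow> Y i \<in> K" and l: "l < k"
  note c = matrix_convex_combinationD[OF comb]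
  note d = carrier_matD[OF c(5)[OF l]] SMnD(3,4)[OF c(4)[OF l], of j] SMnD(3,4)[OF Xs(2), of j]
  have "realification (Y l) j * real_column (V l) = real_column (V l) * X j"
    by (rule arveson_extremeD(3)[OF X realification_combination[OF comb] RK[OF Y] l])
  then have "real_column (Y l j * V l) = real_column (V l * cmat (X j))"
    using d by (simp add: realification_mult_real_column[OF c(4)[OF l]] real_column_mult_real)
  then show "Y l j * V l = V l * cmat (X j)"
    using d by (intro real_column_inj) auto
qed

section \<open>Real combinations of realifications\<close>

text \<open>
  For \<open>z = \<i>\<close> this is an isometry that intertwines the realification of a complex tuple with the
  tuple, and for \<open>z = - \<i>\<close> one that intertwines it with the conjugate tuple; the two have orthogonal
  ranges.
\<close>

definition real_embedding :: "complex \<Rightarrow> nat \<Rightarrow> complex mat" where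
  "real_embedding z n = vcat (complex_of_real (1 / sqrt 2) \<cdot>\<^sub>m 1\<^sub>m n)
     ((complex_of_real (1 / sqrt 2) * z) \<cdot>\<^sub>m 1\<^sub>m n)"

lemma real_embedding_carrier:
  "real_embedding z n \<in> carrier_mat (n + n) n"
  "dim_row (real_embedding z n) = n + n" "dim_col (real_embedding z n) = n"
  by (auto simp: real_embedding_def intro!: carrier_matI)

lemma real_embedding_gram:
  "(real_embedding z n)\<^sup>\<dagger> * real_embedding w n = ((1 + cnj z * w) / 2) \<cdot>\<^sub>m 1\<^sub>m n"
proof -
  have s: "complex_of_real (1 / sqrt 2) * complex_of_real (1 / sqrt 2) = 1 / 2"
    by (simp flip: of_real_mult)
  have "(real_embedding z n)\<^sup>\<dagger> * real_embedding w n =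
      ((complex_of_real (1 / sqrt 2) * complex_of_real (1 / sqrt 2)) * (1 + cnj z * w)) \<cdot>\<^sub>m 1\<^sub>m n"
    unfolding real_embedding_def
    by (subst adjoint_vcat_mult_vcat)
      (auto simp: adjoint_smult mult_smult_dim smult_mult_dim algebra_simps simp del: of_real_divide intro!: eq_matI)
  then show ?thesis
    unfolding s by (simp add: field_simps)
qed

lemma cmat_realification_mult_embedding:
  assumes Z: "Z \<in> SMn n"
  shows "cmat (realification Z j) * real_embedding \<i> n = real_embedding \<i> n * Z j"
proof -
  note d = SMnD(3,4)[OF Z, of j]
  let ?s = "complex_of_real (1 / sqrt 2)"
  have cm: "cmat (realification Z j) = four_block_mat
      (cmat (map_mat Re (Z j))) (cmat (map_mat Im (Z j)))
      (cmat (transpose_mat (map_mat Im (Z j)))) (cmat (map_mat Re (Z j)))"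
    using d by (auto simp: realification_def intro!: eq_matI)
  have "cmat (realification Z j) * real_embedding \<i> n =
      vcat (cmat (map_mat Re (Z j)) * (?s \<cdot>\<^sub>m 1\<^sub>m n) + cmat (map_mat Im (Z j)) * ((?s * \<i>) \<cdot>\<^sub>m 1\<^sub>m n))
        (cmat (transpose_mat (map_mat Im (Z j))) * (?s \<cdot>\<^sub>m 1\<^sub>m n) + cmat (map_mat Re (Z j)) * ((?s * \<i>) \<cdot>\<^sub>m 1\<^sub>m n))"
    unfolding cm real_embedding_def
    using d by (intro four_block_mult_vcat[where r = n and c = n and c' = n and r' = n])
      (auto intro!: carrier_matI)
  also have "\<dots> = vcat (?s \<cdot>\<^sub>m Z j) ((?s * \<i>) \<cdot>\<^sub>m Z j)"
  proof (intro arg_cong2[where f = vcat] eq_matI)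
    fix a b
    assume "a < dim_row ((?s * \<i>) \<cdot>\<^sub>m Z j)" "b < dim_col ((?s * \<i>) \<cdot>\<^sub>m Z j)"
    then have ab: "a < n" "b < n" using d by auto
    show "(cmat (transpose_mat (map_mat Im (Z j))) * (?s \<cdot>\<^sub>m 1\<^sub>m n) + cmat (map_mat Re (Z j)) * ((?s * \<i>) \<cdot>\<^sub>m 1\<^sub>m n)) $$ (a, b) =
        ((?s * \<i>) \<cdot>\<^sub>m Z j) $$ (a, b)"
      using ab d self_adjoint_Re_Im(2)[OF Z ab(2) ab(1), of j]
      by (simp add: mult_smult_dim complex_eq_iff del: of_real_divide)
  next
    fix a b
    assume "a < dim_row (?s \<cdot>\<^sub>m Z j)" "b < dim_col (?s \<cdot>\<^sub>m Z j)"
    then have ab: "a < n" "b < n" using d by auto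
    show "(cmat (map_mat Re (Z j)) * (?s \<cdot>\<^sub>m 1\<^sub>m n) + cmat (map_mat Im (Z j)) * ((?s * \<i>) \<cdot>\<^sub>m 1\<^sub>m n)) $$ (a, b) =
        (?s \<cdot>\<^sub>m Z j) $$ (a, b)"
      using ab d by (simp add: mult_smult_dim complex_eq_iff del: of_real_divide)
  qed (use d in auto)
  also have "\<dots> = real_embedding \<i> n * Z j"
  proof (rule eq_matI)
    fix a b assume "a < dim_row (real_embedding \<i> n * Z j)" "b < dim_col (real_embedding \<i> n * Z j)"
    then have ab: "a < n + n" "b < n" using d by (auto simp: real_embedding_carrier)
    have "(real_embedding \<i> n * Z j) $$ (a, b) = (\<Sum>l<n. real_embedding \<i> n $$ (a, l) * Z j $$ (l, b))"
      using ab d by (subst mult_index) (auto simp: real_embedding_carrier)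
    also have "\<dots> = (\<Sum>l<n. (if (if a < n then a else a - n) = l
        then (if a < n then ?s else ?s * \<i>) * Z j $$ (l, b) else 0))"
      using ab by (intro sum.cong) (auto simp: real_embedding_def vcat_index)
    also have "\<dots> = (if a < n then ?s else ?s * \<i>) * Z j $$ (if a < n then a else a - n, b)"
      using ab by (subst sum.delta') auto
    finally show "vcat (?s \<cdot>\<^sub>m Z j) ((?s * \<i>) \<cdot>\<^sub>m Z j) $$ (a, b) = (real_embedding \<i> n * Z j) $$ (a, b)"
      using ab d by (auto simp: vcat_index)
  qed (use d in \<open>auto simp: real_embedding_carrier\<close>)
  finally show ?thesis .
qed

lemma map_cnj_mult: "dim_col A = dim_row B \<Longrightarrow> map_mat cnj (A * B) = map_mat cnj A * map_mat cnj B"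
  by (rule eq_matI) (auto simp: mult_index simp del: index_mult_mat(1))

lemma map_cnj_real_embedding: "map_mat cnj (real_embedding z n) = real_embedding (cnj z) n"
  by (rule eq_matI) (auto simp: real_embedding_def vcat_index)

lemma conj_tuple_SMn:
  assumes "Z \<in> SMn n"
  shows "conj_tuple Z \<in> SMn n"
proof -
  have "(map_mat cnj (Z j))\<^sup>\<dagger> = map_mat cnj ((Z j)\<^sup>\<dagger>)" for j
    by (rule eq_matI) auto
  then show ?thesis
    using SMnD[OF assms] by (simp add: SMn_def conj_tuple_def)
qed

text \<open>
  Over the complex numbers the realification of \<open>Z\<close> is unitarily equivalent to the direct sum of \<open>Z\<close>
  and its conjugate, which lies in \<open>K\<close> because \<open>K\<close> is closed under conjugation.
\<close>

lemma realification_mem_real_points: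
  fixes K :: "('g::finite, complex) mtuple set"
  assumes K: "matrix_convex K" and conj: "K = conj_tuple ` K" and Z: "Z \<in> K"
  shows "realification Z \<in> real_points K"
proof -
  obtain n where n: "1 \<le> n" and Zs: "Z \<in> SMn n"
    using SM_memD[OF matrix_convexD(1)[OF K] Z] .
  let ?J = "real_embedding \<i> n" and ?J' = "real_embedding (- \<i>) n"
  let ?R = "\<lambda>j. cmat (realification Z j)"
  note d = real_embedding_carrier[of \<i> n] real_embedding_carrier[of "- \<i>" n] SMnD(3,4)[OF Zs]
    realification_dim(2,3)[OF Zs] SMnD(3,4)[OF conj_tuple_SMn[OF Zs]]
  have RJ: "?R j * ?J = ?J * Z j" for j
    by (rule cmat_realification_mult_embedding[OF Zs])
  have RJ': "?R j * ?J' = ?J' * conj_tuple Z j" for j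
  proof -
    have "map_mat cnj (?R j) = ?R j"
      by (rule eq_matI) auto
    then show ?thesis
      using arg_cong[OF RJ, of "map_mat cnj" j] d
      by (simp add: map_cnj_mult map_cnj_real_embedding conj_tuple_def)
  qed
  have U: "hcat ?J ?J' \<in> carrier_mat (n + n) (n + n)"
    by (intro hcat_carrier real_embedding_carrier)
  have "(hcat ?J ?J')\<^sup>\<dagger> * hcat ?J ?J' = 1\<^sub>m (n + n)"
    using d by (subst adjoint_hcat_mult_hcat) (auto simp: real_embedding_gram intro!: eq_matI)
  then have JJ: "?J * ?J\<^sup>\<dagger> + ?J' * ?J'\<^sup>\<dagger> = 1\<^sub>m (n + n)"
    using square_isometry_right_inverse[OF U] d by (simp add: hcat_mult_adjoint_hcat)
  define V where "V i = (if i = 0 then ?J\<^sup>\<dagger> else ?J'\<^sup>\<dagger>)" for i :: nat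
  define Y where "Y i = (if i = 0 then Z else conj_tuple Z)" for i :: nat
  have two: "mat_sum (n + n) (n + n) 2 A = A 0 + A 1"
    if "A 0 \<in> carrier_mat (n + n) (n + n)" "A 1 \<in> carrier_mat (n + n) (n + n)"
    for A :: "nat \<Rightarrow> complex mat"
    using that by (simp add: numeral_2_eq_2 mat_sum_Suc)
  have "matrix_convex_combination (n + n) 2 (\<lambda>_. n) V Y ?R"
  proof (rule matrix_convex_combinationI)
    show "1 \<le> n + n" "1 \<le> n" using n by auto
    show "Y i \<in> SMn n" for i
      using Zs conj_tuple_SMn[OF Zs] by (auto simp: Y_def)
    show "V i \<in> carrier_mat n (n + n)" for i
      unfolding V_def using real_embedding_carrier by auto
    have "mat_sum (n + n) (n + n) 2 (\<lambda>i. (V i)\<^sup>\<dagger> * V i) = (V 0)\<^sup>\<dagger> * V 0 + (V 1)\<^sup>\<dagger> * V 1"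
      by (rule two; rule carrier_matI; simp add: V_def d)
    then show "mat_sum (n + n) (n + n) 2 (\<lambda>i. (V i)\<^sup>\<dagger> * V i) = 1\<^sub>m (n + n)"
      by (simp add: V_def JJ)
    fix j
    have "mat_sum (n + n) (n + n) 2 (\<lambda>i. (V i)\<^sup>\<dagger> * Y i j * V i) =
        (V 0)\<^sup>\<dagger> * Y 0 j * V 0 + (V 1)\<^sup>\<dagger> * Y 1 j * V 1"
      by (rule two; rule carrier_matI; simp add: V_def Y_def d)
    also have "\<dots> = ?R j * (?J * ?J\<^sup>\<dagger>) + ?R j * (?J' * ?J'\<^sup>\<dagger>)"
      using d by (simp add: V_def Y_def RJ[symmetric] RJ'[symmetric] mult_assoc_dim)
    also have "\<dots> = ?R j"
      using d by (simp add: mult_add_dim[symmetric] JJ)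
    finally show "?R j = mat_sum (n + n) (n + n) 2 (\<lambda>i. (V i)\<^sup>\<dagger> * Y i j * V i)"
      by simp
  qed
  moreover have "Y i \<in> K" for i
    using Z conj by (auto simp: Y_def)
  ultimately have "?R \<in> K"
    using matrix_convexD(2)[OF K] by blast
  then show ?thesis
    using real_points_iff[OF matrix_convexD(1)[OF K]] by blast
qed

text \<open>
  If \<open>D = (A, B)\<close> is real, then \<open>D * J\<close> is a nonzero multiple of \<open>A + \<i> * B\<close>.
\<close>

lemma cmat_mult_embedding_eq_zero:
  assumes D: "D \<in> carrier_mat m (n + n)" and zero: "cmat D * real_embedding \<i> n = 0\<^sub>m m n"
  shows "D = 0\<^sub>m m (n + n)"
proof -
  note d = carrier_matD[OF D]
  let ?s = "complex_of_real (1 / sqrt 2)"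
  have entries: "D $$ (a, b) = 0 \<and> D $$ (a, n + b) = 0" if ab: "a < m" "b < n" for a b
  proof -
    have "(cmat D * real_embedding \<i> n) $$ (a, b) =
        (\<Sum>l<n + n. cmat D $$ (a, l) * real_embedding \<i> n $$ (l, b))"
      using ab d by (subst mult_index) (auto simp: real_embedding_carrier)
    also have "\<dots> = (\<Sum>l<n. if l = b then of_real (D $$ (a, l)) * ?s else 0) +
        (\<Sum>l<n. if l = b then of_real (D $$ (a, n + l)) * (?s * \<i>) else 0)"
      unfolding sum_lessThan_add using ab d
      by (intro arg_cong2[where f = "(+)"] sum.cong) (auto simp: real_embedding_def vcat_index)
    also have "\<dots> = ?s * Complex (D $$ (a, b)) (D $$ (a, n + b))"
      using ab by (simp add: complex_eq_iff)
    finally have "?s * Complex (D $$ (a, b)) (D $$ (a, n + b)) = 0"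
      using ab zero by simp
    then show ?thesis
      by (simp add: complex_eq_iff)
  qed
  show ?thesis
  proof (rule eq_matI)
    fix a b assume "a < dim_row (0\<^sub>m m (n + n) :: real mat)" "b < dim_col (0\<^sub>m m (n + n) :: real mat)"
    then have ab: "a < m" "b < n + n" by auto
    then show "D $$ (a, b) = 0\<^sub>m m (n + n) $$ (a, b)"
      using entries[OF ab(1), of b] entries[OF ab(1), of "b - n"] by (cases "b < n") auto
  qed (use d in auto)
qed

lemma embedding_isometry: "(real_embedding \<i> n)\<^sup>\<dagger> * real_embedding \<i> n = 1\<^sub>m n"
  by (auto simp: real_embedding_gram intro!: eq_matI)

lemma embedding_compress_realification:
  assumes "Z \<in> SMn n"
  shows "(real_embedding \<i> n)\<^sup>\<dagger> * cmat (realification Z j) * real_embedding \<i> n = Z j"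
proof -
  note d = real_embedding_carrier[of \<i> n] SMnD(3,4)[OF assms, of j] realification_dim(2,3)[OF assms, of j]
  have "(real_embedding \<i> n)\<^sup>\<dagger> * cmat (realification Z j) * real_embedding \<i> n =
      (real_embedding \<i> n)\<^sup>\<dagger> * real_embedding \<i> n * Z j"
    using d by (simp add: mult_assoc_dim cmat_realification_mult_embedding[OF assms])
  then show ?thesis
    using d by (simp add: embedding_isometry)
qed

text \<open>
  Compressing by the embedding turns a real combination for the realification into a complex one for
  \<open>Z\<close>.
\<close>

lemma realification_combination_compress:
  assumes comb: "matrix_convex_combination n k N V Y (realification Z)" and Z: "Z \<in> SMn m" and m: "1 \<le> m"
  shows "matrix_convex_combination m k N (\<lambda>i. cmat (V i) * real_embedding \<i> m)
    (\<lambda>i j. cmat (Y i j)) Z"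
proof -
  have "n = m + m"
    using matrix_convex_combinationD(2)[OF comb] realification_SMn[OF Z] SMn_unique by blast
  then have "real_embedding \<i> m \<in> carrier_mat n m"
    by (simp add: real_embedding_carrier)
  from combination_compress[OF cmat_combination[OF comb] this embedding_isometry m]
  show ?thesis
    by (simp add: embedding_compress_realification[OF Z])
qed

text \<open>
  For a real combination of the realification, the intertwining relation holds after multiplication
  by the embedding, which can be cancelled because both sides are real.
\<close>

lemma arveson_extreme_realification:
  fixes K :: "('g::finite, complex) mtuple set"
  assumes K: "matrix_convex K" and RK: "realification Z \<in> real_points K"
    and Z: "arveson_extreme n K Z"
  shows "arveson_extreme (n + n) (real_points K) (realification Z)"
proof (rule arveson_extremeI[OF RK])
  note Zs = arveson_extremeD(2)[OF Z]
  have n: "1 \<le> n"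
    using SM_size_ge_1[OF matrix_convexD(1)[OF K] arveson_extremeD(1)[OF Z] Zs] .
  show "realification Z \<in> SMn (n + n)"
    by (rule realification_SMn[OF Zs])
  fix k N V Y l j
  assume comb: "matrix_convex_combination (n + n) k N V Y (realification Z)"
    and Y: "\<And>i. i < k \<Longrightarrow> Y i \<in> real_points K" and l: "l < k"
  let ?J = "real_embedding \<i> n"
  note c = matrix_convex_combinationD[OF comb]
  note d = carrier_matD[OF c(5)[OF l]] SMnD(3,4)[OF c(4)[OF l], of j] SMnD(3,4)[OF Zs, of j]
    real_embedding_carrier[of \<i> n] realification_dim(2,3)[OF Zs, of j]
  have "(\<lambda>j. cmat (Y i j)) \<in> K" if "i < k" for i
    using Y[OF that] real_points_iff[OF matrix_convexD(1)[OF K]] by blast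
  from arveson_extremeD(3)[OF Z realification_combination_compress[OF comb Zs n] this l]
  have "cmat (Y l j) * (cmat (V l) * ?J) = cmat (V l) * ?J * Z j" .
  then have eq: "cmat (Y l j) * (cmat (V l) * ?J) = cmat (V l) * (cmat (realification Z j) * ?J)"
    using d by (simp add: cmat_realification_mult_embedding[OF Zs] mult_assoc_dim)
  define D where "D = Y l j * V l - V l * realification Z j"
  have carr: "Y l j * V l \<in> carrier_mat (N l) (n + n)" "V l * realification Z j \<in> carrier_mat (N l) (n + n)"
    by (rule carrier_matI; simp add: d)+
  have D: "D \<in> carrier_mat (N l) (n + n)"
    unfolding D_def by (rule minus_carrier_mat[OF carr(2)])
  have "cmat D * ?J = 0\<^sub>m (N l) n"
    using d by (simp add: D_def cmat_minus cmat_mult minus_mult_dim mult_assoc_dim eq)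
  then have "D = 0\<^sub>m (N l) (n + n)"
    by (rule cmat_mult_embedding_eq_zero[OF D])
  then show "Y l j * V l = V l * realification Z j"
    unfolding D_def by (rule minus_eq_zero_mat) (rule carr)+
qed

section \<open>The real and the complex field\<close>

lemma complex_eigenvector:
  fixes A :: "complex mat"
  assumes A: "A \<in> carrier_mat n n" and n: "0 < n"
  shows "\<exists>v\<in>carrier_mat n 1. \<exists>c. v \<noteq> 0\<^sub>m n 1 \<and> A * v = c \<cdot>\<^sub>m v"
proof -
  obtain c where "eigenvalue A c"
    using spectrum_non_empty[OF A n] by (auto simp: spectrum_def)
  then obtain v where v: "v \<in> carrier_vec n" "v \<noteq> 0\<^sub>v n" "A *\<^sub>v v = c \<cdot>\<^sub>v v"
    using A by (auto simp: eigenvalue_def eigenvector_def)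
  define w where "w = mat n 1 (\<lambda>(a, b). v $ a)"
  have w: "w \<in> carrier_mat n 1" by (simp add: w_def)
  have "w \<noteq> 0\<^sub>m n 1"
  proof
    assume "w = 0\<^sub>m n 1"
    then have "w $$ (a, 0) = 0" if "a < n" for a
      using that by simp
    then have "v = 0\<^sub>v n"
      using v(1) by (intro eq_vecI) (auto simp: w_def)
    with v(2) show False by simp
  qed
  moreover have "A * w = c \<cdot>\<^sub>m w"
  proof (rule eq_matI)
    fix a b assume "a < dim_row (c \<cdot>\<^sub>m w)" "b < dim_col (c \<cdot>\<^sub>m w)"
    then have ab: "a < n" "b = 0" by (auto simp: w_def)
    have "(A * w) $$ (a, b) = (A *\<^sub>v v) $ a"
      using ab A v(1) by (auto simp: w_def scalar_prod_def intro!: sum.cong)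
    then show "(A * w) $$ (a, b) = (c \<cdot>\<^sub>m w) $$ (a, b)"
      using ab v by (simp add: w_def)
  qed (use A w in auto)
  ultimately show ?thesis
    using w by blast
qed

text \<open>
  A symmetric real matrix has a complex eigenvector; its eigenvalue is real, so the real and the
  imaginary part of the vector are eigenvectors unless they vanish, and they do not both vanish.
\<close>

lemma real_symmetric_eigenvector:
  fixes A :: "real mat"
  assumes A: "A \<in> carrier_mat n n" and sym: "A\<^sup>\<dagger> = A" and n: "0 < n"
  shows "\<exists>v\<in>carrier_mat n 1. \<exists>c. v \<noteq> 0\<^sub>m n 1 \<and> A * v = c \<cdot>\<^sub>m v"
proof -
  obtain w c where w: "w \<in> carrier_mat n 1" "w \<noteq> 0\<^sub>m n 1" and Aw: "cmat A * w = c \<cdot>\<^sub>m w"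
    using complex_eigenvector[of "cmat A" n] A n by auto
  note d = carrier_matD[OF A] carrier_matD[OF w(1)]
  have ww: "(w\<^sup>\<dagger> * w) $$ (0, 0) \<noteq> 0"
  proof
    assume "(w\<^sup>\<dagger> * w) $$ (0, 0) = 0"
    then have "w\<^sup>\<dagger> * w = 0\<^sub>m 1 1"
      using d by (intro eq_matI) auto
    then show False
      using gram_eq_zero[OF w(1)] w(2) by simp
  qed
  have "w\<^sup>\<dagger> * (cmat A * w) = (cmat A * w)\<^sup>\<dagger> * w"
    using d by (simp add: adjoint_mult mult_assoc_dim cmat_adjoint[symmetric] sym)
  then have "c \<cdot>\<^sub>m (w\<^sup>\<dagger> * w) = cnj c \<cdot>\<^sub>m (w\<^sup>\<dagger> * w)"
    by (simp add: Aw mult_smult_dim smult_mult_dim adjoint_smult)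
  from arg_cong[OF this, of "\<lambda>B. B $$ (0, 0)"] have "c * (w\<^sup>\<dagger> * w) $$ (0, 0) = cnj c * (w\<^sup>\<dagger> * w) $$ (0, 0)"
    using d by simp
  then have "c = cnj c"
    using ww by simp
  then have Im_c: "Im c = 0"
    by (simp add: complex_eq_iff)
  have Im_cmat: "map_mat Im (cmat A) = 0\<^sub>m n n"
    using d by (auto intro!: eq_matI)
  have re: "A * map_mat Re w = Re c \<cdot>\<^sub>m map_mat Re w"
    using arg_cong[OF Aw, of "map_mat Re"] d Im_c
    by (auto simp: map_Re_mult Im_cmat intro!: eq_matI)
  have im: "A * map_mat Im w = Re c \<cdot>\<^sub>m map_mat Im w"
    using arg_cong[OF Aw, of "map_mat Im"] d Im_c
    by (auto simp: map_Im_mult Im_cmat intro!: eq_matI)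
  have "map_mat Re w \<noteq> 0\<^sub>m n 1 \<or> map_mat Im w \<noteq> 0\<^sub>m n 1"
  proof (rule ccontr)
    assume "\<not> ?thesis"
    then have "map_mat Re w = 0\<^sub>m n 1" "map_mat Im w = 0\<^sub>m n 1" by auto
    then have "Re (w $$ (a, 0)) = 0 \<and> Im (w $$ (a, 0)) = 0" if "a < n" for a
      using that d by (metis index_map_mat(1) index_zero_mat(1) less_one)
    then have "w = 0\<^sub>m n 1"
      using d by (auto simp: complex_eq_iff intro!: eq_matI)
    with w(2) show False by simp
  qed
  then show ?thesis
    using re im w(1) by (metis map_carrier_mat)
qed

interpretation complex_field: spectral_field "TYPE(complex)"
proof
  fix a :: complex assume "0 \<le> a"
  then have "conjugate (complex_of_real (sqrt (Re a))) * complex_of_real (sqrt (Re a)) = a"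
    by (simp add: less_eq_complex_def complex_eq_iff)
  then show "\<exists>s. conjugate s * s = a" by blast
next
  fix A :: "complex mat" and n
  assume "A \<in> carrier_mat n n" "A\<^sup>\<dagger> = A" "0 < n"
  then show "\<exists>v\<in>carrier_mat n 1. \<exists>c. v \<noteq> 0\<^sub>m n 1 \<and> A * v = c \<cdot>\<^sub>m v"
    using complex_eigenvector by blast
qed

interpretation real_field: spectral_field "TYPE(real)"
proof
  fix a :: real assume "0 \<le> a"
  then have "conjugate (sqrt a) * sqrt a = a" by simp
  then show "\<exists>s. conjugate s * s = a" by blast
next
  fix A :: "real mat" and n
  assume "A \<in> carrier_mat n n" "A\<^sup>\<dagger> = A" "0 < n"
  then show "\<exists>v\<in>carrier_mat n 1. \<exists>c. v \<noteq> 0\<^sub>m n 1 \<and> A * v = c \<cdot>\<^sub>m v"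
    by (rule real_symmetric_eigenvector)
qed

section \<open>Free extreme points over both fields\<close>

text \<open>
  Over the complex numbers \<open>Y\<close> may fail to be free extreme, but it stays Arveson extreme.
\<close>

lemma free_extreme_real_point_combination:
  fixes K :: "('g::finite, complex) mtuple set"
  assumes K: "matrix_convex K" and conj: "K = conj_tuple ` K"
    and Y: "Y \<in> free_extreme_points (real_points K)" "Y \<in> SMn n"
  shows "combination_of_total_size_le (free_extreme_points K) n (\<lambda>j. cmat (Y j))"
proof -
  have "arveson_extreme n (real_points K) Y"
    by (rule real_field.free_extreme_imp_arveson_extreme[OF matrix_convex_real_points[OF K] Y])
  then have "arveson_extreme n K (\<lambda>j. cmat (Y j))"
    by (intro arveson_extreme_complexification[OF K] realification_mem_real_points[OF K conj])
  then show ?thesis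
    by (rule complex_field.arveson_extreme_combination[OF K])
qed

lemma free_extreme_realification_combination:
  fixes K :: "('g::finite, complex) mtuple set"
  assumes K: "matrix_convex K" and conj: "K = conj_tuple ` K"
    and Z: "Z \<in> free_extreme_points K" "Z \<in> SMn n"
  shows "combination_of_total_size_le (free_extreme_points (real_points K)) (n + n) (realification Z)"
proof -
  have "realification Z \<in> real_points K"
    using realification_mem_real_points[OF K conj] free_extreme_points_subset Z(1) by blast
  then have "arveson_extreme (n + n) (real_points K) (realification Z)"
    using arveson_extreme_realification[OF K] complex_field.free_extreme_imp_arveson_extreme[OF K Z]
    by blast
  then show ?thesis
    by (rule real_field.arveson_extreme_combination[OF matrix_convex_real_points[OF K]])
qed

lemma combination_of_realification:
  fixes K :: "('g::finite, complex) mtuple set"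
  assumes K: "matrix_convex K" and conj: "K = conj_tuple ` K" and X: "X \<in> K"
    and comb: "combination_of_total_size_le (free_extreme_points (real_points K)) m (realification X)"
  shows "combination_of_total_size_le (free_extreme_points K) m X"
proof -
  obtain n k N V Y where c: "matrix_convex_combination n k N V Y (realification X)"
    and Y: "\<And>i. i < k \<Longrightarrow> Y i \<in> free_extreme_points (real_points K)" and m: "(\<Sum>i<k. N i) \<le> m"
    using comb unfolding combination_of_total_size_le_def by blast
  obtain p where p: "1 \<le> p" "X \<in> SMn p"
    using SM_memD[OF matrix_convexD(1)[OF K] X] .
  show ?thesis
    by (rule combination_compose[OF realification_combination_compress[OF c p(2,1)]
          free_extreme_real_point_combination[OF K conj Y matrix_convex_combinationD(4)[OF c]] m])
qed

lemma matrix_convex_hull_free_extreme_subset: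
  assumes "matrix_convex K"
  shows "matrix_convex_hull (free_extreme_points K) \<subseteq> K"
  using matrix_convexD(2)[OF assms] free_extreme_points_subset[of K]
  unfolding matrix_convex_hull_def by blast

theorem theorem2p4:
  fixes K :: "('g::finite, complex) mtuple set"
  assumes "matrix_convex K"
    and "K = conj_tuple ` K"
  shows "(K = matrix_convex_hull (free_extreme_points K) \<longleftrightarrow>
          real_points K = matrix_convex_hull (free_extreme_points (real_points K))) \<and>
         (\<forall>X\<in>K. realification X \<in> real_points K \<and>
           (\<forall>m. combination_of_total_size_le (free_extreme_points (real_points K)) m (realification X)
              \<longrightarrow> combination_of_total_size_le (free_extreme_points K) m X))"
proof -
  let ?KR = "real_points K"
  note R = realification_mem_real_points[OF assms] and bound = combination_of_realification[OF assms]
  have "?KR \<subseteq> matrix_convex_hull (free_extreme_points ?KR)"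
    if hull: "K = matrix_convex_hull (free_extreme_points K)"
  proof
    fix X assume "X \<in> ?KR"
    then have "(\<lambda>j. cmat (X j)) \<in> matrix_convex_hull (free_extreme_points K)"
      using hull real_points_iff[OF matrix_convexD(1)[OF assms(1)]] by blast
    then obtain n k N V Z where c: "matrix_convex_combination n k N V Z (\<lambda>j. cmat (X j))"
      and Z: "\<And>i. i < k \<Longrightarrow> Z i \<in> free_extreme_points K"
      unfolding matrix_convex_hull_def by blast
    have "combination_of_total_size_le (free_extreme_points ?KR) (\<Sum>i<k. N i + N i) X"
      by (rule combination_compose[OF realification_combination[OF c]
            free_extreme_realification_combination[OF assms Z matrix_convex_combinationD(4)[OF c]]
            order_refl])
    then show "X \<in> matrix_convex_hull (free_extreme_points ?KR)"
      unfolding matrix_convex_hull_iff by blast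
  qed
  moreover have "K \<subseteq> matrix_convex_hull (free_extreme_points K)"
    if "?KR = matrix_convex_hull (free_extreme_points ?KR)"
    using R bound that unfolding set_eq_iff matrix_convex_hull_iff subset_iff by metis
  ultimately show ?thesis
    using matrix_convex_hull_free_extreme_subset[OF assms(1)]
      matrix_convex_hull_free_extreme_subset[OF matrix_convex_real_points[OF assms(1)]] R bound
    by blast
qed

end
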